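(* Let $(A,p_l)$ be a non-unital, self-induced Fréchet algebra and let $n\in\mathbb{N}$. Then $A^{\#}$ is $(2n+1)$-weakly amenable if and only if every continuous derivation $D:A\to A^{(2n+1)}$ for which there exists $T\in A^*$ such that $$\langle ab,T\rangle=\langle a,D(b)\rangle+\langle b,D(a)\rangle\qquad\text{for all }a,b\in A$$ is inner. If this is the case, then $T=0$ (for every such $D$ and $T$).
   Context: All spaces are complex and $\mathbb{N}=\{1,2,\dots\}$. A Fréchet algebra $(A,p_l)$ is an algebra that is complete and Hausdorff for the topology generated by a separating, increasing sequence $(p_l)_{l\in\mathbb{N}}$ of submultiplicative seminorms. The unitization of $A$ is $A^{\#}=A\oplus\mathbb{C}e$ with product $(a,\lambda)(b,\mu)=(ab+\mu a+\lambda b,\lambda\mu)$ and seminorms $q_l(a,\lambda)=p_l(a)+|\lambda|$; it is a Fréchet algebra with identity $e=(0,1)$. For a locally convex space $X$, $X^*$ is its continuous dual with the strong topology (uniform convergence on bounded subsets of $X$); $X^{(0)}=X$ and $X^{(n)}=(X^{(n-1)})^*$. If $B$ is a Fréchet algebra and $X$ a locally convex $B$-bimodule, then $X^*$ is a $B$-bimodule via $\langle b\cdot f,x\rangle=\langle f,x\cdot b\rangle$ and $\langle f\cdot b,x\rangle=\langle f,b\cdot x\rangle$; iterating, every $X^{(n)}$ is a $B$-bimodule. $B$ is a bimodule over itself by multiplication. A continuous derivation $D:B\to X$ is a continuous linear map with $D(ab)=a\cdot D(b)+D(a)\cdot b$ for all $a,b\in B$; it is inner if there is $x\in X$ with $D(b)=b\cdot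 x-x\cdot b$ for all $b\in B$. $B$ is $n$-weakly amenable if every continuous derivation $B\to B^{(n)}$ is inner. In pairings such as $\langle a,D(b)\rangle$ with $a\in A$ and $D(b)\in A^{(2n+1)}$, $a$ is regarded as an element of $A^{(2n)}$ via the canonical embedding $A\to A^{(2n)}$. A Fréchet algebra $B$ is self-induced if (i) $\overline{B^2}=B$, where $B^2$ is the linear span of all products $ab$ with $a,b\in B$, and (ii) every continuous balanced bilinear map $\varphi:B\times B\to\mathbb{C}$ (balanced: $\varphi(ac,b)=\varphi(a,cb)$ for all $a,b,c\in B$) has the form $\varphi(a,b)=f(ab)$ for some $f\in B^*$. *)

theory Defs
  imports "HOL-Analysis.Analysis" "HOL-Library.Function_Algebras"
begin

section \<open>Complex vector spaces and algebras\<close>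

class complex_vector = ab_group_add +
  fixes scaleC :: "complex \<Rightarrow> 'a \<Rightarrow> 'a"  (infixr "*\<^sub>C" 75)
  assumes scaleC_add_right: "c *\<^sub>C (x + y) = c *\<^sub>C x + c *\<^sub>C y"
    and scaleC_add_left: "(c + d) *\<^sub>C x = c *\<^sub>C x + d *\<^sub>C x"
    and scaleC_scaleC: "c *\<^sub>C d *\<^sub>C x = (c * d) *\<^sub>C x"
    and scaleC_one: "1 *\<^sub>C x = x"

text \<open>Algebras are associative, but neither commutative nor unital in general.\<close>

class complex_algebra = complex_vector + ring +
  assumes mult_scaleC_left: "(c *\<^sub>C x) * y = c *\<^sub>C (x * y)"
    and mult_scaleC_right: "x * (c *\<^sub>C y) = c *\<^sub>C (x * y)"

global_interpretation complex_vector: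
  vector_space "scaleC :: complex \<Rightarrow> 'a \<Rightarrow> 'a :: complex_vector"
  by unfold_locales (simp_all add: scaleC_add_right scaleC_add_left scaleC_scaleC scaleC_one)

instantiation complex :: complex_algebra
begin
definition scaleC_complex_def: "c *\<^sub>C (z :: complex) = c * z"
instance by standard (simp_all add: scaleC_complex_def algebra_simps)
end

instantiation "fun" :: (type, complex_vector) complex_vector
begin
definition scaleC_fun_def: "c *\<^sub>C f = (\<lambda>x. c *\<^sub>C f x)"
instance
  by standard (simp_all add: scaleC_fun_def plus_fun_def scaleC_add_right scaleC_add_left
      scaleC_scaleC scaleC_one)
end

instantiation prod :: (complex_vector, complex_vector) complex_vector
begin
definition scaleC_prod_def: "c *\<^sub>C z = (c *\<^sub>C fst z, c *\<^sub>C snd z)"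
instance
  by standard (simp_all add: scaleC_prod_def scaleC_add_right scaleC_add_left
      scaleC_scaleC scaleC_one)
end


section \<open>Locally convex spaces and their strong duals\<close>

text \<open>
  The underlying vector space is a subspace of an ambient type, since the spaces
  \<open>X\<^sup>(\<^sup>n\<^sup>)\<close> occurring below have to share one type.
\<close>

record 'x lcs =
  carrier :: "'x set"
  seminorms :: "('x \<Rightarrow> real) set"

definition seminorm_on :: "'x::complex_vector set \<Rightarrow> ('x \<Rightarrow> real) \<Rightarrow> bool" where
  "seminorm_on S p \<longleftrightarrow>
     (\<forall>x\<in>S. \<forall>y\<in>S. p (x + y) \<le> p x + p y) \<and> (\<forall>c. \<forall>x\<in>S. p (c *\<^sub>C x) = cmod c * p x)"

definition locally_convex :: "'x::complex_vector lcs \<Rightarrow> bool" where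
  "locally_convex E \<longleftrightarrow>
     complex_vector.subspace (carrier E) \<and> (\<forall>p\<in>seminorms E. seminorm_on (carrier E) p)"

definition lc_topology :: "'x::complex_vector lcs \<Rightarrow> 'x topology" where
  "lc_topology E = topology_generated_by
     (insert (carrier E)
       {{y \<in> carrier E. p (y - x) < r} | p x r. p \<in> seminorms E \<and> x \<in> carrier E \<and> 0 < r})"

definition lc_bounded :: "'x::complex_vector lcs \<Rightarrow> 'x set \<Rightarrow> bool" where
  "lc_bounded E B \<longleftrightarrow> B \<subseteq> carrier E \<and> (\<forall>p\<in>seminorms E. bdd_above (p ` B))"

definition clinear_on :: "'x::complex_vector set \<Rightarrow> ('x \<Rightarrow> 'y::complex_vector) \<Rightarrow> bool" where
  "clinear_on S f \<longleftrightarrow>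
     (\<forall>x\<in>S. \<forall>y\<in>S. f (x + y) = f x + f y) \<and> (\<forall>c. \<forall>x\<in>S. f (c *\<^sub>C x) = c *\<^sub>C f x)"

text \<open>
  Functionals are normalised to vanish off the carrier, so that equality of functions is equality
  of functionals on \<open>E\<close>.
\<close>

definition strong_dual :: "'x::complex_vector lcs \<Rightarrow> ('x \<Rightarrow> complex) lcs" where
  "strong_dual E =
    \<lparr>carrier = {f. clinear_on (carrier E) f \<and> continuous_map (lc_topology E) euclidean f \<and>
                   (\<forall>x. x \<notin> carrier E \<longrightarrow> f x = 0)},
     seminorms = {(\<lambda>f. SUP x\<in>B. cmod (f x)) | B. lc_bounded E B \<and> B \<noteq> {}}\<rparr>"

definition lc_iso :: "('x \<Rightarrow> 'y) \<Rightarrow> 'x::complex_vector lcs \<Rightarrow> 'y::complex_vector lcs \<Rightarrow> bool" where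
  "lc_iso h E F \<longleftrightarrow> bij_betw h (carrier E) (carrier F) \<and> clinear_on (carrier E) h \<and>
     homeomorphic_map (lc_topology E) (lc_topology F) h"

lemma lc_topology_nhd:
  assumes "locally_convex E" "openin (lc_topology E) U" "x \<in> U"
  shows "x \<in> carrier E \<and> (\<exists>F e. finite F \<and> F \<subseteq> seminorms E \<and> 0 < e \<and>
           (\<forall>y\<in>carrier E. (\<forall>p\<in>F. p (y - x) < e) \<longrightarrow> y \<in> U))"
proof -
  have "generate_topology_on (insert (carrier E)
       {{y \<in> carrier E. p (y - x) < r} | p x r. p \<in> seminorms E \<and> x \<in> carrier E \<and> 0 < r}) U"
    using assms(2) unfolding lc_topology_def by (simp add: openin_topology_generated_by_iff)
  then show ?thesis
    using assms(3)
  proof (induction arbitrary: x rule: generate_topology_on.induct)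
    case Empty
    then show ?case by simp
  next
    case (Int a b)
    obtain F e where 1: "finite F" "F \<subseteq> seminorms E" "0 < e" "x \<in> carrier E"
      "\<forall>y\<in>carrier E. (\<forall>p\<in>F. p (y - x) < e) \<longrightarrow> y \<in> a"
      using Int.IH(1)[of x] Int.prems by blast
    obtain G d where 2: "finite G" "G \<subseteq> seminorms E" "0 < d"
      "\<forall>y\<in>carrier E. (\<forall>p\<in>G. p (y - x) < d) \<longrightarrow> y \<in> b"
      using Int.IH(2)[of x] Int.prems by blast
    show ?case
      by (intro conjI exI[of _ "F \<union> G"] exI[of _ "min e d"]) (use 1 2 in auto)
  next
    case (UN K)
    then obtain k where k: "k \<in> K" "x \<in> k" by blast
    obtain F e where 1: "finite F" "F \<subseteq> seminorms E" "0 < e" "x \<in> carrier E"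
      "\<forall>y\<in>carrier E. (\<forall>p\<in>F. p (y - x) < e) \<longrightarrow> y \<in> k"
      using UN.IH[OF k] by blast
    show ?case
      by (intro conjI exI[of _ F] exI[of _ e]) (use 1 k in auto)
  next
    case (Basis s)
    show ?case
    proof (cases "s = carrier E")
      case True
      then show ?thesis using Basis.prems by (intro conjI exI[of _ "{}"] exI[of _ 1]) auto
    next
      case False
      then obtain p z r where s: "s = {y \<in> carrier E. p (y - z) < r}" "p \<in> seminorms E"
        "z \<in> carrier E"
        using Basis.hyps by auto
      have sub: "complex_vector.subspace (carrier E)" and p: "seminorm_on (carrier E) p"
        using assms(1) s unfolding locally_convex_def by auto
      have x: "x \<in> carrier E" "p (x - z) < r" using Basis.prems s by auto
      have "y \<in> s" if y: "y \<in> carrier E" "p (y - x) < r - p (x - z)" for y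
      proof -
        have "p ((y - x) + (x - z)) \<le> p (y - x) + p (x - z)"
          using p sub x s y unfolding seminorm_on_def
          by (meson complex_vector.subspace_diff)
        then show ?thesis using y s by simp
      qed
      then show ?thesis
        by (intro conjI exI[of _ "{p}"] exI[of _ "r - p (x - z)"]) (use x s in auto)
    qed
  qed
qed

lemma topspace_lc_topology [simp]: "topspace (lc_topology E) = carrier E"
  unfolding lc_topology_def by (auto simp: topology_generated_by_topspace)

lemma seminorm_on_nonneg:
  assumes "seminorm_on S p" "complex_vector.subspace S" "x \<in> S"
  shows "0 \<le> p x"
proof -
  have m: "(-1) *\<^sub>C x \<in> S" using assms complex_vector.subspace_scale by blast
  have "p (0 *\<^sub>C x) = cmod 0 * p x" using assms unfolding seminorm_on_def by blast
  then have "p (0 *\<^sub>C x) = 0" by simp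
  moreover have "p (x + (-1) *\<^sub>C x) \<le> p x + p ((-1) *\<^sub>C x)"
    using assms m unfolding seminorm_on_def by blast
  moreover have "p ((-1) *\<^sub>C x) = cmod (-1) * p x"
    using assms unfolding seminorm_on_def by blast
  moreover have "x + (-1) *\<^sub>C x = 0 *\<^sub>C x"
    by (simp add: complex_vector.scale_minus_left scaleC_one)
  ultimately show ?thesis by simp
qed


section \<open>Fr\'echet algebras\<close>

text \<open>
  The sequence of seminorms is indexed from \<open>0\<close>.  The topology being given by countably many
  seminorms, completeness is completeness for Cauchy sequences.
\<close>

definition seminorm_space :: "(nat \<Rightarrow> 'a::complex_vector \<Rightarrow> real) \<Rightarrow> 'a lcs" where
  "seminorm_space p = \<lparr>carrier = UNIV, seminorms = range p\<rparr>"

locale frechet_algebra =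
  fixes p :: "nat \<Rightarrow> 'a::complex_algebra \<Rightarrow> real"
  assumes seminorm: "seminorm_on UNIV (p l)"
    and submultiplicative: "p l (a * b) \<le> p l a * p l b"
    and increasing: "l \<le> m \<Longrightarrow> p l a \<le> p m a"
    and separating: "(\<And>l. p l a = 0) \<Longrightarrow> a = 0"
    and complete: "(\<And>l e. 0 < e \<Longrightarrow> \<exists>N. \<forall>i\<ge>N. \<forall>j\<ge>N. p l (x i - x j) < e) \<Longrightarrow>
      \<exists>a. limitin (lc_topology (seminorm_space p)) x a sequentially"

definition unital :: "'a::complex_algebra itself \<Rightarrow> bool" where
  "unital _ \<longleftrightarrow> (\<exists>u::'a. \<forall>a. u * a = a \<and> a * u = a)"

definition self_induced :: "(nat \<Rightarrow> 'a::complex_algebra \<Rightarrow> real) \<Rightarrow> bool" where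
  "self_induced p \<longleftrightarrow>
     (let X = seminorm_space p in
       lc_topology X closure_of complex_vector.span {a * b | a b. True} = UNIV \<and>
       (\<forall>\<phi>. (\<forall>a. clinear_on UNIV (\<phi> a)) \<and> (\<forall>b. clinear_on UNIV (\<lambda>a. \<phi> a b)) \<and>
            continuous_map (prod_topology (lc_topology X) (lc_topology X)) euclidean
              (\<lambda>(a, b). \<phi> a b) \<and>
            (\<forall>a b c. \<phi> (a * c) b = \<phi> a (c * b)) \<longrightarrow>
          (\<exists>f\<in>carrier (strong_dual X). \<forall>a b. \<phi> a b = f (a * b))))"


subsection \<open>Unitization\<close>

datatype 'a unitization = Unitization (alg_part: 'a) (scalar_part: complex)

instantiation unitization :: (complex_algebra) complex_algebra
begin

definition "0 = Unitization 0 0"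
definition "x + y = Unitization (alg_part x + alg_part y) (scalar_part x + scalar_part y)"
definition "- x = Unitization (- alg_part x) (- scalar_part x)"
definition "x - y = Unitization (alg_part x - alg_part y) (scalar_part x - scalar_part y)"
definition "c *\<^sub>C x = Unitization (c *\<^sub>C alg_part x) (c * scalar_part x)"
definition "x * y = Unitization
  (alg_part x * alg_part y + scalar_part y *\<^sub>C alg_part x + scalar_part x *\<^sub>C alg_part y)
  (scalar_part x * scalar_part y)"

lemmas unitization_defs = zero_unitization_def plus_unitization_def uminus_unitization_def
  minus_unitization_def scaleC_unitization_def times_unitization_def

instance
  by standard
    (auto simp: unitization_defs unitization.expand algebra_simps scaleC_add_right scaleC_add_left
      scaleC_scaleC scaleC_one mult_scaleC_left mult_scaleC_right)

end

definition unitization_seminorms ::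
  "(nat \<Rightarrow> 'a \<Rightarrow> real) \<Rightarrow> nat \<Rightarrow> 'a::complex_algebra unitization \<Rightarrow> real" where
  "unitization_seminorms p l x = p l (alg_part x) + cmod (scalar_part x)"

lemma limitin_seminorm_space:
  assumes p: "\<And>l. seminorm_on UNIV (p l)"
  shows "limitin (lc_topology (seminorm_space p)) x a sequentially \<longleftrightarrow>
    (\<forall>l. \<forall>e>0. \<exists>N. \<forall>i\<ge>N. p l (x i - a) < e)"
proof -
  have E: "locally_convex (seminorm_space p)"
    using p unfolding locally_convex_def seminorm_space_def by auto
  have top: "topspace (lc_topology (seminorm_space p)) = UNIV" by (simp add: seminorm_space_def)
  have p0: "p l 0 = 0" for l
  proof -
    have "p l (0 *\<^sub>C 0) = cmod 0 * p l 0" using p unfolding seminorm_on_def by blast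
    then show ?thesis by simp
  qed
  show ?thesis
  proof
    assume lim: "limitin (lc_topology (seminorm_space p)) x a sequentially"
    show "\<forall>l. \<forall>e>0. \<exists>N. \<forall>i\<ge>N. p l (x i - a) < e"
    proof (intro allI impI)
      fix l and e :: real assume e: "0 < e"
      let ?U = "{y \<in> carrier (seminorm_space p). p l (y - a) < e}"
      have "openin (lc_topology (seminorm_space p)) ?U"
        unfolding lc_topology_def
      proof (rule topology_generated_by_Basis, rule insertI2, rule CollectI,
          intro exI[of _ "p l"] exI[of _ a] exI[of _ e] conjI refl)
      qed (use e in \<open>simp_all add: seminorm_space_def\<close>)
      moreover have "a \<in> ?U" using e p0 by (simp add: seminorm_space_def)
      ultimately have "eventually (\<lambda>i. x i \<in> ?U) sequentially"
        using lim unfolding limitin_def by blast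
      then show "\<exists>N. \<forall>i\<ge>N. p l (x i - a) < e" by (auto simp: eventually_sequentially)
    qed
  next
    assume lim: "\<forall>l. \<forall>e>0. \<exists>N. \<forall>i\<ge>N. p l (x i - a) < e"
    show "limitin (lc_topology (seminorm_space p)) x a sequentially"
      unfolding limitin_def top
    proof (intro conjI allI impI UNIV_I; elim conjE)
      fix U assume "openin (lc_topology (seminorm_space p)) U" "a \<in> U"
      then obtain F e where F: "finite F" "F \<subseteq> range p" "0 < e"
        "\<forall>y. (\<forall>q\<in>F. q (y - a) < e) \<longrightarrow> y \<in> U"
        using lc_topology_nhd[OF E, of U a] unfolding seminorm_space_def by auto
      have "\<forall>q\<in>F. eventually (\<lambda>i. q (x i - a) < e) sequentially"
        using lim F(2,3) unfolding eventually_sequentially by blast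
      then have "eventually (\<lambda>i. \<forall>q\<in>F. q (x i - a) < e) sequentially"
        using F(1) by (simp add: eventually_ball_finite)
      then show "eventually (\<lambda>i. x i \<in> U) sequentially"
        by (rule eventually_mono) (use F(4) in blast)
    qed
  qed
qed

lemma unitization_identity:
  "Unitization 0 1 * x = x" "x * Unitization 0 1 = x"
  by (simp_all add: times_unitization_def scaleC_one)

lemma frechet_algebra_unitization:
  assumes "frechet_algebra p"
  shows "frechet_algebra (unitization_seminorms p)"
proof -
  interpret frechet_algebra p by fact
  have tri: "p l (a + b) \<le> p l a + p l b" and sc: "p l (c *\<^sub>C a) = cmod c * p l a" for l a b c
    using seminorm[of l] unfolding seminorm_on_def by auto
  have nn: "0 \<le> p l a" for l a
    using seminorm_on_nonneg[OF seminorm] by simp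
  let ?q = "unitization_seminorms p"
  have q: "seminorm_on UNIV (?q l)" for l
    unfolding seminorm_on_def unitization_seminorms_def
    using tri sc
    by (auto simp: plus_unitization_def scaleC_unitization_def norm_mult algebra_simps
        intro: add_mono_thms_linordered_semiring norm_triangle_ineq order_trans[OF add_mono])
  show ?thesis
  proof
    show "seminorm_on UNIV (?q l)" for l by (rule q)
  next
    fix l and x y :: "'a unitization"
    obtain a s b t where [simp]: "x = Unitization a s" "y = Unitization b t"
      by (metis unitization.exhaust)
    have "p l (a * b + t *\<^sub>C a + s *\<^sub>C b) \<le> p l (a * b) + p l (t *\<^sub>C a) + p l (s *\<^sub>C b)"
      using tri[of l "a * b + t *\<^sub>C a" "s *\<^sub>C b"] tri[of l "a * b" "t *\<^sub>C a"] by linarith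
    also have "\<dots> \<le> p l a * p l b + cmod t * p l a + cmod s * p l b"
      using submultiplicative[of l a b] sc by simp
    finally show "?q l (x * y) \<le> ?q l x * ?q l y"
      unfolding unitization_seminorms_def times_unitization_def
      by (simp add: norm_mult algebra_simps)
  next
    fix l m :: nat and x :: "'a unitization" assume "l \<le> m"
    then show "?q l x \<le> ?q m x" unfolding unitization_seminorms_def using increasing by simp
  next
    fix x :: "'a unitization" assume x: "?q l x = 0" for l
    have "p l (alg_part x) = 0" "cmod (scalar_part x) = 0" for l
      using x[of l] nn[of l "alg_part x"] unfolding unitization_seminorms_def
      by (smt (verit) norm_ge_zero)+
    then show "x = 0"
      using separating[of "alg_part x"] by (simp add: zero_unitization_def unitization.expand)
  next
    fix x :: "nat \<Rightarrow> 'a unitization"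
    assume C: "\<exists>N. \<forall>i\<ge>N. \<forall>j\<ge>N. ?q l (x i - x j) < e" if "0 < e" for l e
    have qd: "?q l (y - z) = p l (alg_part y - alg_part z) + cmod (scalar_part y - scalar_part z)"
      for l y z
      unfolding unitization_seminorms_def minus_unitization_def by simp
    have "\<exists>a. limitin (lc_topology (seminorm_space p)) (\<lambda>i. alg_part (x i)) a sequentially"
    proof (rule complete)
      fix l and e :: real assume "0 < e"
      then obtain N where "\<forall>i\<ge>N. \<forall>j\<ge>N. ?q l (x i - x j) < e" using C by blast
      then show "\<exists>N. \<forall>i\<ge>N. \<forall>j\<ge>N. p l (alg_part (x i) - alg_part (x j)) < e"
        unfolding qd by (intro exI[of _ N]) (smt (verit) norm_ge_zero)
    qed
    then obtain a where a: "\<And>l e. 0 < e \<Longrightarrow> \<exists>N. \<forall>i\<ge>N. p l (alg_part (x i) - a) < e"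
      unfolding limitin_seminorm_space[OF seminorm] by blast
    have "Cauchy (\<lambda>i. scalar_part (x i))"
      unfolding Cauchy_def dist_norm
    proof (intro allI impI)
      fix e :: real assume "0 < e"
      then obtain N where "\<forall>i\<ge>N. \<forall>j\<ge>N. ?q 0 (x i - x j) < e" using C by blast
      then show "\<exists>N. \<forall>i\<ge>N. \<forall>j\<ge>N. cmod (scalar_part (x i) - scalar_part (x j)) < e"
        unfolding qd by (intro exI[of _ N]) (smt (verit) nn)
    qed
    then obtain s where s: "(\<lambda>i. scalar_part (x i)) \<longlonglongrightarrow> s"
      using Cauchy_convergent_iff convergent_def by blast
    have "\<exists>N. \<forall>i\<ge>N. ?q l (x i - Unitization a s) < e" if e: "0 < e" for l e
    proof -
      obtain N where N: "\<forall>i\<ge>N. p l (alg_part (x i) - a) < e / 2"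
        using a[of "e / 2" l] e by auto
      obtain K where K: "\<forall>i\<ge>K. cmod (scalar_part (x i) - s) < e / 2"
        using LIMSEQ_D[OF s, of "e / 2"] e by auto
      show ?thesis
        unfolding qd
      proof (intro exI[of _ "max N K"] allI impI)
        fix i assume "max N K \<le> i"
        then have "p l (alg_part (x i) - a) < e / 2" "cmod (scalar_part (x i) - s) < e / 2"
          using N K by auto
        then show "p l (alg_part (x i) - alg_part (Unitization a s)) +
            cmod (scalar_part (x i) - scalar_part (Unitization a s)) < e"
          by simp
      qed
    qed
    then show "\<exists>a. limitin (lc_topology (seminorm_space ?q)) x a sequentially"
      unfolding limitin_seminorm_space[OF q] by blast
  qed
qed


section \<open>Iterated duals\<close>

text \<open>
  The strong dual of a space over the type \<open>'x\<close> is a space over \<open>'x \<Rightarrow> complex\<close>, so a family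
  \<open>X\<^sup>(\<^sup>0\<^sup>), \<dots>, X\<^sup>(\<^sup>N\<^sup>)\<close> with variable \<open>N\<close> can only be accommodated in one type up to isomorphism.  A dual
  tower of height \<open>N\<close> over \<open>B\<close> consists of locally convex spaces \<open>X\<^sub>0, \<dots>, X\<^sub>N\<close> inside a
  type \<open>'u\<close> and topological linear isomorphisms from \<open>B\<close> onto \<open>X\<^sub>0\<close> and from the strong dual of
  \<open>X\<^sub>k\<close> onto \<open>X\<^sub>k\<^sub>+\<^sub>1\<close>; thus \<open>X\<^sub>k\<close> is a copy of \<open>B\<^sup>(\<^sup>k\<^sup>)\<close>.  The lemmas \<open>ex_dual_tower_0\<close> and
  \<open>ex_dual_tower_Suc\<close> show that for each numeral \<open>N\<close> every Fr\'echet algebra has a dual tower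
  of height \<open>N\<close> over a suitable type.
\<close>

record ('a, 'u) dual_tower =
  level :: "nat \<Rightarrow> 'u lcs"
  base :: "'a \<Rightarrow> 'u"
  step :: "nat \<Rightarrow> ('u \<Rightarrow> complex) \<Rightarrow> 'u"

definition is_dual_tower ::
  "(nat \<Rightarrow> 'a::complex_algebra \<Rightarrow> real) \<Rightarrow> nat \<Rightarrow> ('a, 'u::complex_vector) dual_tower \<Rightarrow> bool" where
  "is_dual_tower p N M \<longleftrightarrow>
     (\<forall>k\<le>N. locally_convex (level M k)) \<and>
     lc_iso (base M) (seminorm_space p) (level M 0) \<and>
     (\<forall>k<N. lc_iso (step M k) (strong_dual (level M k)) (level M (Suc k)))"

text \<open>The pairing \<open>\<langle>x, f\<rangle>\<close> of \<open>x \<in> X\<^sub>k\<close> with \<open>f \<in> X\<^sub>k\<^sub>+\<^sub>1\<close>.\<close>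

definition pairing ::
  "('a, 'u::complex_vector) dual_tower \<Rightarrow> nat \<Rightarrow> 'u \<Rightarrow> 'u \<Rightarrow> complex" where
  "pairing M k x f = inv_into (carrier (strong_dual (level M k))) (step M k) f x"

text \<open>The element \<open>f \<in> X\<^sub>k\<^sub>+\<^sub>1\<close> with \<open>\<langle>x, f\<rangle> = \<phi> x\<close> for all \<open>x \<in> X\<^sub>k\<close>.\<close>

definition functional ::
  "('a, 'u::complex_vector) dual_tower \<Rightarrow> nat \<Rightarrow> ('u \<Rightarrow> complex) \<Rightarrow> 'u" where
  "functional M k \<phi> = step M k (\<lambda>x. if x \<in> carrier (level M k) then \<phi> x else 0)"

text \<open>\<open>left_act M k b x\<close> is \<open>b \<cdot> x\<close> and \<open>right_act M k b x\<close> is \<open>x \<cdot> b\<close>, for \<open>x \<in> X\<^sub>k\<close>.\<close>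

fun left_act right_act ::
  "('a::complex_algebra, 'u::complex_vector) dual_tower \<Rightarrow> nat \<Rightarrow> 'a \<Rightarrow> 'u \<Rightarrow> 'u" where
  "left_act M 0 b x = base M (b * inv (base M) x)"
| "left_act M (Suc k) b f = functional M k (\<lambda>x. pairing M k (right_act M k b x) f)"
| "right_act M 0 b x = base M (inv (base M) x * b)"
| "right_act M (Suc k) b f = functional M k (\<lambda>x. pairing M k (left_act M k b x) f)"

text \<open>The canonical embedding of the algebra into its dual of order \<open>2m\<close>.\<close>

primrec canonical :: "('a, 'u::complex_vector) dual_tower \<Rightarrow> nat \<Rightarrow> 'a \<Rightarrow> 'u" where
  "canonical M 0 a = base M a"
| "canonical M (Suc m) a =
     functional M (Suc (2 * m)) (\<lambda>f. pairing M (2 * m) (canonical M m a) f)"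


section \<open>Derivations and weak amenability\<close>

definition continuous_derivation ::
  "(nat \<Rightarrow> 'a::complex_algebra \<Rightarrow> real) \<Rightarrow> ('a, 'u::complex_vector) dual_tower \<Rightarrow> nat \<Rightarrow>
     ('a \<Rightarrow> 'u) \<Rightarrow> bool" where
  "continuous_derivation p M k D \<longleftrightarrow>
     range D \<subseteq> carrier (level M k) \<and> clinear_on UNIV D \<and>
     continuous_map (lc_topology (seminorm_space p)) (lc_topology (level M k)) D \<and>
     (\<forall>a b. D (a * b) = left_act M k a (D b) + right_act M k b (D a))"

definition inner_derivation ::
  "('a::complex_algebra, 'u::complex_vector) dual_tower \<Rightarrow> nat \<Rightarrow> ('a \<Rightarrow> 'u) \<Rightarrow> bool" where
  "inner_derivation M k D \<longleftrightarrow>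
     (\<exists>x\<in>carrier (level M k). \<forall>b. D b = left_act M k b x - right_act M k b x)"

definition weakly_amenable ::
  "(nat \<Rightarrow> 'a::complex_algebra \<Rightarrow> real) \<Rightarrow> ('a, 'u::complex_vector) dual_tower \<Rightarrow> nat \<Rightarrow> bool" where
  "weakly_amenable p M k \<longleftrightarrow>
     (\<forall>D. continuous_derivation p M k D \<longrightarrow> inner_derivation M k D)"


section \<open>Existence of dual towers\<close>

lemma functional_bounded:
  assumes E: "locally_convex E" and f: "f \<in> carrier (strong_dual E)" and B: "lc_bounded E B"
  shows "bdd_above ((\<lambda>x. cmod (f x)) ` B)"
proof -
  have sub: "complex_vector.subspace (carrier E)" using E unfolding locally_convex_def by auto
  have lin: "clinear_on (carrier E) f" and cont: "continuous_map (lc_topology E) euclidean f"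
    using f unfolding strong_dual_def by auto
  have z: "0 \<in> carrier E" using sub complex_vector.subspace_0 by blast
  have f0: "f 0 = 0"
    using lin z unfolding clinear_on_def
    by (metis add.right_neutral add_cancel_right_right)
  define U where "U = {x \<in> topspace (lc_topology E). f x \<in> ball 0 1}"
  have U: "openin (lc_topology E) U"
    unfolding U_def using cont by (rule openin_continuous_map_preimage) auto
  have U0: "0 \<in> U" unfolding U_def using z f0 by simp
  obtain F e where F: "finite F" "F \<subseteq> seminorms E" "0 < e"
    "\<forall>y\<in>carrier E. (\<forall>p\<in>F. p (y - 0) < e) \<longrightarrow> y \<in> U"
    using lc_topology_nhd[OF E U U0] by (elim conjE exE)
  have "\<forall>p\<in>F. \<exists>c. \<forall>x\<in>B. p x \<le> c"
    using B F(2) unfolding lc_bounded_def bdd_above_def by fastforce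
  then obtain c where c: "\<forall>p\<in>F. \<forall>x\<in>B. p x \<le> c p" by metis
  define C where "C = 1 + (\<Sum>p\<in>F. \<bar>c p\<bar>)"
  have C: "0 < C" unfolding C_def by (smt (verit) sum_nonneg abs_ge_zero)
  have pC: "p x < C" if "p \<in> F" "x \<in> B" for p x
  proof -
    have "p x \<le> \<bar>c p\<bar>" using c that by force
    also have "\<dots> \<le> (\<Sum>p\<in>F. \<bar>c p\<bar>)"
      using F(1) that by (intro member_le_sum) auto
    finally show ?thesis unfolding C_def by simp
  qed
  have "cmod (f x) \<le> C / e" if x: "x \<in> B" for x
  proof -
    have xE: "x \<in> carrier E" using B x unfolding lc_bounded_def by auto
    define y where "y = complex_of_real (e / C) *\<^sub>C x"
    have yE: "y \<in> carrier E" unfolding y_def using sub xE complex_vector.subspace_scale by blast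
    have "p y < e" if p: "p \<in> F" for p
    proof -
      have "p y = cmod (complex_of_real (e / C)) * p x"
        using E F(2) p xE unfolding y_def locally_convex_def seminorm_on_def by blast
      also have "\<dots> = e / C * p x" using F(3) C by (simp add: norm_divide)
      also have "\<dots> < e / C * C" using pC[OF p x] F(3) C by (intro mult_strict_left_mono) auto
      finally show ?thesis using C by simp
    qed
    then have "y \<in> U" using F(4) yE by simp
    then have "cmod (f y) < 1" unfolding U_def by simp
    moreover have "f y = complex_of_real (e / C) * f x"
      using lin xE unfolding clinear_on_def y_def by (simp add: scaleC_complex_def)
    ultimately have "e / C * cmod (f x) < 1" using F(3) C by (simp add: norm_mult norm_divide)
    then show ?thesis using F(3) C by (simp add: field_simps)
  qed
  then show ?thesis by (auto simp: bdd_above_def)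
qed

lemma locally_convex_strong_dual:
  assumes E: "locally_convex E"
  shows "locally_convex (strong_dual E)"
  unfolding locally_convex_def
proof (intro conjI ballI)
  show "complex_vector.subspace (carrier (strong_dual E))"
    unfolding complex_vector.subspace_def
  proof (intro conjI ballI allI)
    show "0 \<in> carrier (strong_dual E)"
      by (simp add: strong_dual_def clinear_on_def zero_fun_def scaleC_complex_def)
  next
    fix f g assume "f \<in> carrier (strong_dual E)" "g \<in> carrier (strong_dual E)"
    moreover from this have "continuous_map (lc_topology E) euclidean (\<lambda>x. f x + g x)"
      by (intro continuous_map_add) (auto simp: strong_dual_def)
    ultimately show "f + g \<in> carrier (strong_dual E)"
      by (simp add: strong_dual_def clinear_on_def plus_fun_def scaleC_complex_def algebra_simps)
  next
    fix c f assume "f \<in> carrier (strong_dual E)"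
    moreover from this have "continuous_map (lc_topology E) euclidean ((\<lambda>z. c * z) \<circ> f)"
      by (intro continuous_map_compose[where X' = euclidean])
        (auto simp: strong_dual_def intro!: continuous_intros)
    ultimately show "c *\<^sub>C f \<in> carrier (strong_dual E)"
      by (simp add: strong_dual_def clinear_on_def scaleC_fun_def scaleC_complex_def algebra_simps o_def)
  qed
next
  fix q assume "q \<in> seminorms (strong_dual E)"
  then obtain B where B: "lc_bounded E B" "B \<noteq> {}" and q: "q = (\<lambda>f. SUP x\<in>B. cmod (f x))"
    unfolding strong_dual_def by auto
  note bdd = functional_bounded[OF E _ B(1)]
  show "seminorm_on (carrier (strong_dual E)) q"
    unfolding seminorm_on_def
  proof (intro conjI ballI allI)
    fix f g assume fg: "f \<in> carrier (strong_dual E)" "g \<in> carrier (strong_dual E)"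
    show "q (f + g) \<le> q f + q g"
      unfolding q
    proof (rule cSUP_least[OF B(2)])
      fix x assume x: "x \<in> B"
      have "cmod ((f + g) x) \<le> cmod (f x) + cmod (g x)"
        by (simp add: plus_fun_def norm_triangle_ineq)
      also have "\<dots> \<le> (SUP x\<in>B. cmod (f x)) + (SUP x\<in>B. cmod (g x))"
        using cSUP_upper[OF x bdd[OF fg(1)]] cSUP_upper[OF x bdd[OF fg(2)]] by simp
      finally show "cmod ((f + g) x) \<le> (SUP x\<in>B. cmod (f x)) + (SUP x\<in>B. cmod (g x))" .
    qed
  next
    fix c f assume f: "f \<in> carrier (strong_dual E)"
    have le: "(SUP x\<in>B. cmod (d * g x)) \<le> cmod d * (SUP x\<in>B. cmod (g x))"
      if "bdd_above ((\<lambda>x. cmod (g x)) ` B)" for d and g :: "'a \<Rightarrow> complex"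
      using that by (intro cSUP_least B(2)) (auto simp: norm_mult intro!: mult_left_mono cSUP_upper)
    show "q (c *\<^sub>C f) = cmod c * q f"
    proof (cases "c = 0")
      case True
      then show ?thesis using B(2) unfolding q by (simp add: scaleC_fun_def scaleC_complex_def)
    next
      case False
      have "bdd_above ((\<lambda>x. cmod (c * f x)) ` B)"
        using bdd[OF f] unfolding bdd_above_def norm_mult
        by (metis (no_types, lifting) imageE image_eqI mult_left_mono norm_ge_zero)
      then have "(SUP x\<in>B. cmod (inverse c * (c * f x)))
          \<le> cmod (inverse c) * (SUP x\<in>B. cmod (c * f x))"
        by (rule le)
      then have "cmod c * (SUP x\<in>B. cmod (f x)) \<le> (SUP x\<in>B. cmod (c * f x))"
        using False by (simp add: norm_divide field_simps)
      with le[OF bdd[OF f], of c] show ?thesis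
        unfolding q by (simp add: scaleC_fun_def scaleC_complex_def)
    qed
  qed
qed

text \<open>Linear isomorphisms identifying the given families of seminorms.\<close>

definition lc_isometry :: "('x \<Rightarrow> 'y) \<Rightarrow> 'x::complex_vector lcs \<Rightarrow> 'y::complex_vector lcs \<Rightarrow> bool" where
  "lc_isometry h E F \<longleftrightarrow> bij_betw h (carrier E) (carrier F) \<and> clinear_on (carrier E) h \<and>
     (\<forall>q\<in>seminorms F. \<exists>p\<in>seminorms E. \<forall>x\<in>carrier E. q (h x) = p x) \<and>
     (\<forall>p\<in>seminorms E. \<exists>q\<in>seminorms F. \<forall>x\<in>carrier E. q (h x) = p x)"

lemma clinear_on_diff:
  assumes "clinear_on S f" "complex_vector.subspace S" "x \<in> S" "y \<in> S"
  shows "f (x - y) = f x - f y"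
proof -
  have "x - y \<in> S" using assms complex_vector.subspace_diff by blast
  then have "f ((x - y) + y) = f (x - y) + f y" using assms unfolding clinear_on_def by blast
  then show ?thesis by simp
qed

lemma lc_isometry_continuous:
  assumes h: "h ` carrier E = carrier F" "clinear_on (carrier E) h"
    and E: "complex_vector.subspace (carrier E)"
    and sn: "\<forall>q\<in>seminorms F. \<exists>p\<in>seminorms E. \<forall>x\<in>carrier E. q (h x) = p x"
  shows "continuous_map (lc_topology E) (lc_topology F) h"
proof (subst (2) lc_topology_def, rule continuous_on_generated_topo)
  show "h ` topspace (lc_topology E) \<subseteq> \<Union> (insert (carrier F)
      {{y \<in> carrier F. p (y - x) < r} |p x r. p \<in> seminorms F \<and> x \<in> carrier F \<and> 0 < r})"
    using h(1) by auto
next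
  fix U assume U: "U \<in> insert (carrier F)
      {{y \<in> carrier F. p (y - x) < r} |p x r. p \<in> seminorms F \<and> x \<in> carrier F \<and> 0 < r}"
  show "openin (lc_topology E) (h -` U \<inter> topspace (lc_topology E))"
  proof (cases "U = carrier F")
    case True
    then have "h -` U \<inter> topspace (lc_topology E) = topspace (lc_topology E)" using h(1) by auto
    then show ?thesis by (metis openin_topspace)
  next
    case False
    then obtain q z r where q: "U = {y \<in> carrier F. q (y - z) < r}" "q \<in> seminorms F"
      "z \<in> carrier F" "0 < r"
      using U by auto
    then obtain w where w: "w \<in> carrier E" "z = h w" using h(1) by auto
    obtain p where p: "p \<in> seminorms E" "\<forall>x\<in>carrier E. q (h x) = p x" using sn q by blast
    have "q (h x - z) = p (x - w)" if "x \<in> carrier E" for x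
      using clinear_on_diff[OF h(2) E that w(1)] p(2) E that w complex_vector.subspace_diff
      by metis
    then have "h -` U \<inter> topspace (lc_topology E) = {x \<in> carrier E. p (x - w) < r}"
      using q(1) h(1) by auto
    also have "openin (lc_topology E) \<dots>"
      unfolding lc_topology_def by (rule topology_generated_by_Basis) (use p q w in auto)
    finally show ?thesis .
  qed
qed

lemma lc_isometry_inverse:
  assumes h: "lc_isometry h E F" and E: "complex_vector.subspace (carrier E)"
    and g: "\<And>x. x \<in> carrier E \<Longrightarrow> g (h x) = x"
  shows "lc_isometry g F E"
proof -
  have im: "h ` carrier E = carrier F" and inj: "inj_on h (carrier E)"
    using h unfolding lc_isometry_def bij_betw_def by auto
  have lin: "clinear_on (carrier E) h" using h unfolding lc_isometry_def by blast
  have "bij_betw g (carrier F) (carrier E)"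
    using g by (intro bij_betw_byWitness[where f' = h]) (auto simp flip: im)
  moreover have "clinear_on (carrier F) g"
    unfolding clinear_on_def im[symmetric] ball_simps
  proof (intro conjI ballI allI)
    fix x y assume "x \<in> carrier E" "y \<in> carrier E"
    then show "g (h x + h y) = g (h x) + g (h y)"
      using lin g E unfolding clinear_on_def by (metis complex_vector.subspace_add)
  next
    fix c x assume "x \<in> carrier E"
    then show "g (c *\<^sub>C h x) = c *\<^sub>C g (h x)"
      using lin g E unfolding clinear_on_def by (metis complex_vector.subspace_scale)
  qed
  moreover have "\<exists>q\<in>seminorms F. \<forall>y\<in>carrier F. p (g y) = q y" if p: "p \<in> seminorms E" for p
  proof -
    obtain q where q: "q \<in> seminorms F" "\<forall>x\<in>carrier E. q (h x) = p x"
      using h p unfolding lc_isometry_def by blast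
    have "\<forall>y\<in>carrier F. p (g y) = q y" unfolding im[symmetric] using g q(2) by simp
    then show ?thesis using q(1) by (rule bexI)
  qed
  moreover have "\<exists>p\<in>seminorms E. \<forall>y\<in>carrier F. p (g y) = q y" if q: "q \<in> seminorms F" for q
  proof -
    obtain p where p: "p \<in> seminorms E" "\<forall>x\<in>carrier E. q (h x) = p x"
      using h q unfolding lc_isometry_def by blast
    have "\<forall>y\<in>carrier F. p (g y) = q y" unfolding im[symmetric] using g p(2) by simp
    then show ?thesis using p(1) by (rule bexI)
  qed
  ultimately show ?thesis unfolding lc_isometry_def by simp
qed

lemma lc_isometry_imp_iso:
  assumes h: "lc_isometry h E F"
    and E: "complex_vector.subspace (carrier E)" and F: "complex_vector.subspace (carrier F)"
  shows "lc_iso h E F"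
proof -
  define g where "g = inv_into (carrier E) h"
  have im: "h ` carrier E = carrier F" and inj: "inj_on h (carrier E)"
    using h unfolding lc_isometry_def bij_betw_def by auto
  have gh: "g (h x) = x" if "x \<in> carrier E" for x unfolding g_def using that inj by simp
  have g: "lc_isometry g F E" by (rule lc_isometry_inverse[OF h E gh])
  have "continuous_map (lc_topology E) (lc_topology F) h"
    using h im E by (intro lc_isometry_continuous) (auto simp: lc_isometry_def)
  moreover have "continuous_map (lc_topology F) (lc_topology E) g"
    using g F by (intro lc_isometry_continuous) (auto simp: lc_isometry_def bij_betw_def)
  ultimately have "homeomorphic_maps (lc_topology E) (lc_topology F) h g"
    unfolding homeomorphic_maps_def using gh by (auto simp flip: im)
  then show ?thesis
    using h homeomorphic_maps_imp_map unfolding lc_isometry_def lc_iso_def by blast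
qed

lemma lc_iso_compose:
  assumes "lc_iso h E F" "lc_iso g F G"
  shows "lc_iso (g \<circ> h) E G"
proof -
  have "h x \<in> carrier F" if "x \<in> carrier E" for x
    using assms that unfolding lc_iso_def bij_betw_def by auto
  then have "clinear_on (carrier E) (g \<circ> h)"
    using assms unfolding lc_iso_def clinear_on_def by auto
  then show ?thesis
    using assms bij_betw_trans homeomorphic_map_compose unfolding lc_iso_def by blast
qed

lemma lc_isometry_dual:
  assumes h: "lc_isometry h E F" and E: "locally_convex E" and F: "locally_convex F"
  shows "lc_isometry (\<lambda>f x. if x \<in> carrier E then f (h x) else 0) (strong_dual F) (strong_dual E)"
    (is "lc_isometry ?R _ _")
proof -
  define g where "g = inv_into (carrier E) h"
  define S where "S = (\<lambda>(f::'a \<Rightarrow> complex) y. if y \<in> carrier F then f (g y) else 0)"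
  have sE: "complex_vector.subspace (carrier E)" and sF: "complex_vector.subspace (carrier F)"
    using E F unfolding locally_convex_def by auto
  have im: "h ` carrier E = carrier F" and inj: "inj_on h (carrier E)"
    using h unfolding lc_isometry_def bij_betw_def by auto
  have gh: "g (h x) = x" if "x \<in> carrier E" for x unfolding g_def using that inj by simp
  have hg: "h (g y) = y" if "y \<in> carrier F" for y
    unfolding g_def using that im f_inv_into_f by metis
  have g: "lc_isometry g F E" by (rule lc_isometry_inverse[OF h sE gh])
  have pull: "(\<lambda>x. if x \<in> carrier A then f (k x) else 0) \<in> carrier (strong_dual A)"
    if k: "lc_isometry k A B" and A: "complex_vector.subspace (carrier A)"
      and f: "f \<in> carrier (strong_dual B)"
    for k f and A :: "'c::complex_vector lcs" and B :: "'d::complex_vector lcs"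
  proof -
    have kc: "k x \<in> carrier B" if "x \<in> carrier A" for x
      using k that unfolding lc_isometry_def bij_betw_def by auto
    have "continuous_map (lc_topology A) (lc_topology B) k"
      using k A by (intro lc_isometry_continuous) (auto simp: lc_isometry_def bij_betw_def)
    then have "continuous_map (lc_topology A) euclidean (f \<circ> k)"
      using f by (intro continuous_map_compose[where X' = "lc_topology B"])
        (auto simp: strong_dual_def)
    then have "continuous_map (lc_topology A) euclidean
        (\<lambda>x. if x \<in> carrier A then f (k x) else 0)"
      by (rule continuous_map_eq) simp
    moreover have "clinear_on (carrier A) (\<lambda>x. if x \<in> carrier A then f (k x) else 0)"
      using k f kc A unfolding strong_dual_def lc_isometry_def clinear_on_def
      by (simp add: complex_vector.subspace_add complex_vector.subspace_scale)
    ultimately show ?thesis unfolding strong_dual_def by simp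
  qed
  have R: "?R f \<in> carrier (strong_dual E)" if "f \<in> carrier (strong_dual F)" for f
    using pull[OF h sE that] .
  have S: "S f \<in> carrier (strong_dual F)" if "f \<in> carrier (strong_dual E)" for f
    unfolding S_def using pull[OF g sF that] .
  have SR: "S (?R f) = f" if "f \<in> carrier (strong_dual F)" for f
    using that hg g unfolding S_def strong_dual_def lc_isometry_def bij_betw_def
    by (fastforce simp: fun_eq_iff)
  have RS: "?R (S f) = f" if "f \<in> carrier (strong_dual E)" for f
    using that gh im unfolding S_def strong_dual_def by (fastforce simp: fun_eq_iff)
  have bij: "bij_betw ?R (carrier (strong_dual F)) (carrier (strong_dual E))"
    by (rule bij_betw_byWitness[where f' = S]) (use R S SR RS in auto)
  have lin: "clinear_on (carrier (strong_dual F)) ?R"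
    unfolding clinear_on_def by (auto simp: fun_eq_iff plus_fun_def scaleC_fun_def scaleC_complex_def)
  have bnd: "lc_bounded B (k ` X)" if k: "lc_isometry k A B" and X: "lc_bounded A X"
    for k X and A :: "'c::complex_vector lcs" and B :: "'d::complex_vector lcs"
    unfolding lc_bounded_def
  proof (intro conjI ballI)
    show "k ` X \<subseteq> carrier B"
      using k X unfolding lc_isometry_def lc_bounded_def bij_betw_def by auto
    fix q assume "q \<in> seminorms B"
    then obtain p where p: "p \<in> seminorms A" "\<forall>x\<in>carrier A. q (k x) = p x"
      using k unfolding lc_isometry_def by blast
    then have "q ` k ` X = p ` X"
      using X unfolding lc_bounded_def image_image by (intro image_cong) auto
    then show "bdd_above (q ` k ` X)" using X p unfolding lc_bounded_def by simp
  qed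
  have SUP: "(SUP x\<in>X. cmod (?R f x)) = (SUP y\<in>h ` X. cmod (f y))" if "X \<subseteq> carrier E" for X f
    unfolding image_image using that by (intro arg_cong[where f = Sup] image_cong) auto
  have s1: "\<exists>p\<in>seminorms (strong_dual F). \<forall>f\<in>carrier (strong_dual F). q (?R f) = p f"
    if q: "q \<in> seminorms (strong_dual E)" for q
  proof -
    obtain X where X: "lc_bounded E X" "X \<noteq> {}" "q = (\<lambda>f. SUP x\<in>X. cmod (f x))"
      using q unfolding strong_dual_def by auto
    have mem: "(\<lambda>f. SUP y\<in>h ` X. cmod (f y)) \<in> seminorms (strong_dual F)"
      using bnd[OF h X(1)] X(2) unfolding strong_dual_def by auto
    have "X \<subseteq> carrier E" using X(1) unfolding lc_bounded_def by blast
    from SUP[OF this] have "\<forall>f\<in>carrier (strong_dual F). q (?R f) = (SUP y\<in>h ` X. cmod (f y))"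
      unfolding X(3) by blast
    then show ?thesis using mem by (rule bexI)
  qed
  have s2: "\<exists>q\<in>seminorms (strong_dual E). \<forall>f\<in>carrier (strong_dual F). q (?R f) = p f"
    if p: "p \<in> seminorms (strong_dual F)" for p
  proof -
    obtain Y where Y: "lc_bounded F Y" "Y \<noteq> {}" "p = (\<lambda>f. SUP y\<in>Y. cmod (f y))"
      using p unfolding strong_dual_def by auto
    have gY: "lc_bounded E (g ` Y)" by (rule bnd[OF g Y(1)])
    have "h ` g ` Y = Y"
      using Y(1) hg unfolding lc_bounded_def image_image by (force simp: subset_iff)
    moreover have "g ` Y \<subseteq> carrier E" using gY unfolding lc_bounded_def by blast
    ultimately have "(SUP x\<in>g ` Y. cmod (?R f x)) = p f" for f
      using SUP[of "g ` Y" f] Y(3) by metis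
    then have "\<forall>f\<in>carrier (strong_dual F). (SUP x\<in>g ` Y. cmod (?R f x)) = p f" by blast
    moreover have "(\<lambda>f. SUP x\<in>g ` Y. cmod (f x)) \<in> seminorms (strong_dual E)"
      using gY Y(2) unfolding strong_dual_def by auto
    ultimately show ?thesis by (rule bexI[where x = "\<lambda>f. SUP x\<in>g ` Y. cmod (f x)"])
  qed
  show ?thesis unfolding lc_isometry_def using bij lin s1 s2 by blast
qed

definition lc_image :: "('x \<Rightarrow> 'y) \<Rightarrow> ('y \<Rightarrow> 'x) \<Rightarrow> 'x lcs \<Rightarrow> 'y lcs" where
  "lc_image h g E = \<lparr>carrier = h ` carrier E, seminorms = (\<lambda>p. p \<circ> g) ` seminorms E\<rparr>"

lemma lc_image:
  assumes E: "locally_convex E" and lin: "clinear_on UNIV h" and gh: "\<And>x. g (h x) = x"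
  shows "lc_isometry h E (lc_image h g E)" "locally_convex (lc_image h g E)"
proof -
  have sE: "complex_vector.subspace (carrier E)" using E unfolding locally_convex_def by auto
  have h: "h (x + y) = h x + h y" "h (c *\<^sub>C x) = c *\<^sub>C h x" for c x y
    using lin unfolding clinear_on_def by auto
  show "lc_isometry h E (lc_image h g E)"
    unfolding lc_isometry_def lc_image_def bij_betw_def clinear_on_def
    using gh h by (auto simp: inj_on_def) (metis gh)
  have "h 0 = 0" using h(2)[of 0 0] by simp
  then have "complex_vector.subspace (h ` carrier E)"
    using sE h unfolding complex_vector.subspace_def by (auto simp: image_iff) metis+
  then show "locally_convex (lc_image h g E)"
    using E gh h[symmetric] unfolding locally_convex_def lc_image_def seminorm_on_def by auto
qed

lemma ex_dual_tower_0:
  assumes "frechet_algebra p"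
  shows "\<exists>M :: ('a::complex_algebra, 'a) dual_tower. is_dual_tower p 0 M"
proof -
  have l: "locally_convex (seminorm_space p)"
    using frechet_algebra.seminorm[OF assms]
    unfolding locally_convex_def seminorm_space_def by auto
  have "lc_iso id (seminorm_space p) (seminorm_space p)"
    unfolding lc_iso_def clinear_on_def by simp
  with l show ?thesis
    unfolding is_dual_tower_def
    by (intro exI[of _ "\<lparr>level = \<lambda>_. seminorm_space p, base = id, step = undefined\<rparr>"]) simp
qed

lemma ex_dual_tower_Suc:
  fixes M :: "('a::complex_algebra, 'u::complex_vector) dual_tower"
  assumes M: "is_dual_tower p N M"
  shows "\<exists>M' :: ('a, 'u \<times> ('u \<Rightarrow> complex)) dual_tower. is_dual_tower p (Suc N) M'"
proof -
  let ?i = "(\<lambda>x. (x, 0)) :: 'u \<Rightarrow> 'u \<times> ('u \<Rightarrow> complex)"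
  let ?j = "(\<lambda>f. (0, f)) :: ('u \<Rightarrow> complex) \<Rightarrow> 'u \<times> ('u \<Rightarrow> complex)"
  define L where "L k = (if k \<le> N then lc_image ?i fst (level M k)
    else lc_image ?j snd (strong_dual (level M N)))" for k
  define R where "R k = (\<lambda>f x. if x \<in> carrier (level M k) then f (?i x) else 0 :: complex)" for k
  define M' where "M' = \<lparr>level = L, base = ?i \<circ> base M,
    step = (\<lambda>k. (if k < N then ?i \<circ> step M k else ?j) \<circ> R k)\<rparr>"
  have lin: "clinear_on UNIV ?i" "clinear_on UNIV ?j"
    unfolding clinear_on_def by (auto simp: scaleC_prod_def)
  have lc: "locally_convex (level M k)" if "k \<le> N" for k
    using M that unfolding is_dual_tower_def by auto
  note im1 = lc_image[OF lc lin(1), of _ fst, simplified]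
  note im2 = lc_image[OF locally_convex_strong_dual[OF lc] lin(2), of _ snd, simplified]
  have sub: "complex_vector.subspace (carrier E)" if "locally_convex E" for E :: "'z::complex_vector lcs"
    using that unfolding locally_convex_def by auto
  have L: "locally_convex (L k)" for k
    unfolding L_def using im1(2) im2(2) by auto
  have i: "lc_iso ?i (level M k) (L k)" if "k \<le> N" for k
    using lc_isometry_imp_iso[OF im1(1)[OF that] sub[OF lc[OF that]] sub[OF im1(2)[OF that]]] that
    unfolding L_def by simp
  have j: "lc_iso ?j (strong_dual (level M N)) (L (Suc N))"
    using lc_isometry_imp_iso[OF im2(1) sub[OF locally_convex_strong_dual[OF lc]] sub[OF im2(2)], of N]
    unfolding L_def by simp
  have R: "lc_iso (R k) (strong_dual (L k)) (strong_dual (level M k))" if "k \<le> N" for k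
  proof -
    have "lc_isometry ?i (level M k) (L k)" using im1(1)[OF that] that unfolding L_def by simp
    then have "lc_isometry (R k) (strong_dual (L k)) (strong_dual (level M k))"
      unfolding R_def by (rule lc_isometry_dual[OF _ lc[OF that] L])
    then show ?thesis
      by (rule lc_isometry_imp_iso) (use L lc[OF that] locally_convex_strong_dual sub in blast)+
  qed
  have b: "lc_iso (?i \<circ> base M) (seminorm_space p) (L 0)"
    using M i[of 0] lc_iso_compose unfolding is_dual_tower_def by blast
  have s: "lc_iso ((if k < N then ?i \<circ> step M k else ?j) \<circ> R k) (strong_dual (L k)) (L (Suc k))"
    if "k < Suc N" for k
  proof (cases "k < N")
    case True
    then have "lc_iso (step M k) (strong_dual (level M k)) (level M (Suc k))"
      using M unfolding is_dual_tower_def by auto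
    then show ?thesis
      using lc_iso_compose[OF R lc_iso_compose[OF _ i]] True by auto
  next
    case False
    then have "k = N" using that by simp
    then show ?thesis using lc_iso_compose[OF R j] by simp
  qed
  have "is_dual_tower p (Suc N) M'"
    unfolding is_dual_tower_def M'_def using L b s by simp
  then show ?thesis by blast
qed

end

theory Submission
  imports Defs
begin

text \<open>
  Level by level, \<open>(A\<^sup>#)\<^sup>(\<^sup>k\<^sup>) = A\<^sup>(\<^sup>k\<^sup>) \<oplus> \<complex>\<close>, and in odd degree an element \<open>a \<in> A\<close> acts by
  \<open>a \<cdot> (f, t) = (a \<cdot> f, \<langle>a, f\<rangle>)\<close> and \<open>(f, t) \<cdot> a = (f \<cdot> a, \<langle>a, f\<rangle>)\<close>. A continuous derivation of \<open>A\<^sup>#\<close>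
  kills the identity, so it amounts to a pair \<open>(D, T)\<close>, and the Leibniz rule says that \<open>D\<close> is a
  derivation and \<open>\<langle>ab, T\<rangle> = \<langle>a, D b\<rangle> + \<langle>b, D a\<rangle>\<close>. The commutator with \<open>(f, t)\<close> is the pair of the
  commutator with \<open>f\<close> and \<open>0\<close>. Hence inner derivations of \<open>A\<^sup>#\<close> have \<open>T = 0\<close>; conversely, if \<open>D\<close>
  is the commutator with \<open>f\<close>, then the right-hand side cancels, \<open>T\<close> vanishes on products, and \<open>T = 0\<close>
  because products span a dense subspace.
\<close>

section \<open>Continuous linear maps and their transposes\<close>

text \<open>The scalar field is made a locally convex space of the same kind as all others, so that
  functionals are treated as continuous linear maps and need no theory of their own.\<close>

abbreviation scalars :: "complex lcs" where
  "scalars \<equiv> seminorm_space (\<lambda>_. cmod)"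

text \<open>The conditions concern the carrier only: the spaces are subspaces of an ambient type,
  and values off the carrier are arbitrary.\<close>

definition continuous_linear ::
  "'x::complex_vector lcs \<Rightarrow> 'y::complex_vector lcs \<Rightarrow> ('x \<Rightarrow> 'y) \<Rightarrow> bool" where
  "continuous_linear E F u \<longleftrightarrow> u ` carrier E \<subseteq> carrier F \<and> clinear_on (carrier E) u \<and>
     continuous_map (lc_topology E) (lc_topology F) u"

section \<open>Locally convex spaces: seminorms, neighbourhoods, continuity of linear maps\<close>

lemma locally_convex_seminorm_space:
  "(\<And>l. seminorm_on UNIV (p l)) \<Longrightarrow> locally_convex (seminorm_space p)"
  unfolding locally_convex_def seminorm_space_def by auto

lemma locally_convex_scalars: "locally_convex scalars"
  by (rule locally_convex_seminorm_space)
    (auto simp: seminorm_on_def scaleC_complex_def norm_mult norm_triangle_ineq)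

lemma carrier_seminorm_space [simp]: "carrier (seminorm_space p) = UNIV"
  by (simp add: seminorm_space_def)

lemma locally_convexD:
  assumes "locally_convex E"
  shows "0 \<in> carrier E"
    and "x \<in> carrier E \<Longrightarrow> y \<in> carrier E \<Longrightarrow> x + y \<in> carrier E"
    and "x \<in> carrier E \<Longrightarrow> y \<in> carrier E \<Longrightarrow> x - y \<in> carrier E"
    and "x \<in> carrier E \<Longrightarrow> c *\<^sub>C x \<in> carrier E"
  using assms unfolding locally_convex_def
  by (simp_all add: complex_vector.subspace_0 complex_vector.subspace_add
      complex_vector.subspace_diff complex_vector.subspace_scale)

lemma seminormD:
  assumes "locally_convex E" "q \<in> seminorms E"
  shows "q 0 = 0"
    and "x \<in> carrier E \<Longrightarrow> y \<in> carrier E \<Longrightarrow> q (x + y) \<le> q x + q y"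
    and "x \<in> carrier E \<Longrightarrow> q (c *\<^sub>C x) = cmod c * q x"
    and "x \<in> carrier E \<Longrightarrow> 0 \<le> q x"
proof -
  have q: "seminorm_on (carrier E) q" "complex_vector.subspace (carrier E)"
    using assms unfolding locally_convex_def by auto
  show sc: "q (c *\<^sub>C x) = cmod c * q x" if "x \<in> carrier E" for c x
    using q that unfolding seminorm_on_def by blast
  show "q 0 = 0" using sc[OF locally_convexD(1)[OF assms(1)], of 0] by simp
  show "q (x + y) \<le> q x + q y" if "x \<in> carrier E" "y \<in> carrier E"
    using q that unfolding seminorm_on_def by blast
  show "0 \<le> q x" if "x \<in> carrier E" using seminorm_on_nonneg[OF q that] .
qed

text \<open>Converse of \<open>lc_topology_nhd\<close>: around each of its points, \<open>U\<close>
  contains a finite intersection of subbasic balls.\<close>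

lemma openin_lc_topologyI:
  assumes E: "locally_convex E" and U: "U \<subseteq> carrier E"
    and nhd: "\<And>x. x \<in> U \<Longrightarrow> \<exists>G e. finite G \<and> G \<subseteq> seminorms E \<and> 0 < e \<and>
      (\<forall>y\<in>carrier E. (\<forall>p\<in>G. p (y - x) < e) \<longrightarrow> y \<in> U)"
  shows "openin (lc_topology E) U"
proof (subst openin_subopen, intro ballI)
  fix x assume x: "x \<in> U"
  obtain G e where G: "finite G" "G \<subseteq> seminorms E" "0 < e"
    "\<forall>y\<in>carrier E. (\<forall>p\<in>G. p (y - x) < e) \<longrightarrow> y \<in> U"
    using nhd[OF x] by (elim exE conjE)
  have xE: "x \<in> carrier E" by (rule subsetD[OF U x])
  \<comment> \<open>Inserting the carrier keeps the family nonempty when \<open>G\<close> is empty,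
    and keeps the intersection inside the space.\<close>
  define T where "T = \<Inter> (insert (carrier E) ((\<lambda>p. {y \<in> carrier E. p (y - x) < e}) ` G))"
  have "openin (lc_topology E) T"
    unfolding T_def
  proof (rule openin_Inter)
    fix S assume S: "S \<in> insert (carrier E) ((\<lambda>p. {y \<in> carrier E. p (y - x) < e}) ` G)"
    show "openin (lc_topology E) S"
      unfolding lc_topology_def
      by (rule topology_generated_by_Basis) (use S G xE in blast)
  qed (use G in auto)
  moreover have "p (x - x) < e" if "p \<in> G" for p
    using seminormD(1)[OF E subsetD[OF G(2) that]] G(3) by simp
  then have "x \<in> T" unfolding T_def using xE by auto
  moreover have "T \<subseteq> U" unfolding T_def using G(4) by auto
  ultimately show "\<exists>T. openin (lc_topology E) T \<and> x \<in> T \<and> T \<subseteq> U" by blast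
qed

lemma openin_seminorm_ball:
  assumes "q \<in> seminorms E" "x \<in> carrier E" "0 < r"
  shows "openin (lc_topology E) {y \<in> carrier E. q (y - x) < r}"
  unfolding lc_topology_def by (rule topology_generated_by_Basis) (use assms in blast)

text \<open>Bridges \<open>strong_dual\<close>, whose functionals are continuous into
  \<open>euclidean\<close>, and \<open>continuous_linear\<close> with target
  \<open>scalars\<close>.\<close>

lemma lc_topology_scalars: "lc_topology scalars = euclidean"
proof (rule topology_eq[THEN iffD2], intro allI iffI)
  fix S :: "complex set"
  assume "openin (lc_topology scalars) S"
  from lc_topology_nhd[OF locally_convex_scalars this]
  have "\<exists>e>0. \<forall>y. dist y x < e \<longrightarrow> y \<in> S" if "x \<in> S" for x
    using that unfolding seminorm_space_def dist_norm by (auto; blast)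
  then show "openin euclidean S" by (simp add: open_dist)
next
  fix S :: "complex set"
  assume "openin euclidean S"
  then have S: "\<And>x. x \<in> S \<Longrightarrow> \<exists>e>0. \<forall>y. dist y x < e \<longrightarrow> y \<in> S"
    by (simp add: open_dist)
  show "openin (lc_topology scalars) S"
  proof (rule openin_lc_topologyI[OF locally_convex_scalars])
    fix x assume "x \<in> S"
    then obtain e where "e > 0" "\<forall>y. dist y x < e \<longrightarrow> y \<in> S" using S by blast
    then show "\<exists>G e. finite G \<and> G \<subseteq> seminorms scalars \<and> 0 < e \<and>
      (\<forall>y\<in>carrier scalars. (\<forall>p\<in>G. p (y - x) < e) \<longrightarrow> y \<in> S)"
      by (intro exI[of _ "{cmod}"] exI[of _ e]) (auto simp: seminorm_space_def dist_norm)
  qed simp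
qed

lemma mem_strong_dual_iff:
  "f \<in> carrier (strong_dual E) \<longleftrightarrow>
    continuous_linear E scalars f \<and> (\<forall>x. x \<notin> carrier E \<longrightarrow> f x = 0)"
  unfolding strong_dual_def continuous_linear_def lc_topology_scalars by auto

text \<open>By linearity, continuity has to be tested at 0 only. The finite set \<open>G\<close>
  appears because the seminorms of a strong dual are not given as a directed sequence.\<close>

lemma continuous_linear_iff:
  assumes E: "locally_convex E" and F: "locally_convex F"
  shows "continuous_linear E F u \<longleftrightarrow> u ` carrier E \<subseteq> carrier F \<and> clinear_on (carrier E) u \<and>
    (\<forall>q\<in>seminorms F. \<forall>r>0. \<exists>G e. finite G \<and> G \<subseteq> seminorms E \<and> 0 < e \<and>
      (\<forall>x\<in>carrier E. (\<forall>p\<in>G. p x < e) \<longrightarrow> q (u x) < r))" (is "_ \<longleftrightarrow> _ \<and> _ \<and> ?R")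
proof -
  have "continuous_map (lc_topology E) (lc_topology F) u \<longleftrightarrow> ?R"
    if im: "u ` carrier E \<subseteq> carrier F" and lin: "clinear_on (carrier E) u"
  proof
    assume cont: "continuous_map (lc_topology E) (lc_topology F) u"
    show ?R
    proof (intro ballI allI impI)
      fix q and r :: real assume q: "q \<in> seminorms F" and r: "0 < r"
      define U where "U = {x \<in> topspace (lc_topology E). u x \<in> {y \<in> carrier F. q (y - 0) < r}}"
      have U: "openin (lc_topology E) U"
        unfolding U_def
        by (rule openin_continuous_map_preimage[OF cont
              openin_seminorm_ball[OF q locally_convexD(1)[OF F] r]])
      have "u 0 = 0"
        using clinear_on_diff[OF lin _ locally_convexD(1)[OF E] locally_convexD(1)[OF E]] E
        unfolding locally_convex_def by simp
      then have "0 \<in> U"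
        unfolding U_def using locally_convexD(1)[OF E] locally_convexD(1)[OF F]
          seminormD(1)[OF F q] r by simp
      from lc_topology_nhd[OF E U this]
      show "\<exists>G e. finite G \<and> G \<subseteq> seminorms E \<and> 0 < e \<and>
          (\<forall>x\<in>carrier E. (\<forall>p\<in>G. p x < e) \<longrightarrow> q (u x) < r)"
        unfolding U_def by simp blast
    qed
  next
    assume R: ?R
    show "continuous_map (lc_topology E) (lc_topology F) u"
      unfolding continuous_map_def
    proof (intro conjI allI impI)
      show "u \<in> topspace (lc_topology E) \<rightarrow> topspace (lc_topology F)" using im by auto
      fix V assume V: "openin (lc_topology F) V"
      show "openin (lc_topology E) {x \<in> topspace (lc_topology E). u x \<in> V}"
      proof (rule openin_lc_topologyI[OF E])
        fix x assume "x \<in> {x \<in> topspace (lc_topology E). u x \<in> V}"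
        then have x: "x \<in> carrier E" "u x \<in> V" by auto
        obtain H r where H: "finite H" "H \<subseteq> seminorms F" "0 < r"
          "\<forall>y\<in>carrier F. (\<forall>q\<in>H. q (y - u x) < r) \<longrightarrow> y \<in> V"
          using lc_topology_nhd[OF F V x(2)] by blast
        have "\<forall>q\<in>H. \<exists>G e. finite G \<and> G \<subseteq> seminorms E \<and> 0 < e \<and>
            (\<forall>x\<in>carrier E. (\<forall>p\<in>G. p x < e) \<longrightarrow> q (u x) < r)"
          using R H by blast
        then obtain G e where G: "\<And>q. q \<in> H \<Longrightarrow> finite (G q) \<and> G q \<subseteq> seminorms E \<and> 0 < e q \<and>
            (\<forall>x\<in>carrier E. (\<forall>p\<in>G q. p x < e q) \<longrightarrow> q (u x) < r)"
          by metis
        \<comment> \<open>One radius serves all of the finitely many seminorms in \<open>H\<close>;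
          the inserted 1 covers the case of empty \<open>H\<close>.\<close>
        define d where "d = Min (insert 1 (e ` H))"
        have d: "0 < d" "\<And>q. q \<in> H \<Longrightarrow> d \<le> e q"
          unfolding d_def using H(1) G by auto
        have "u y \<in> V" if y: "y \<in> carrier E" "\<forall>p\<in>\<Union>(G ` H). p (y - x) < d" for y
        proof -
          have yx: "y - x \<in> carrier E" by (rule locally_convexD(3)[OF E y(1) x(1)])
          have "u (y - x) = u y - u x"
            using clinear_on_diff[OF lin] x y E unfolding locally_convex_def by blast
          moreover have "q (u (y - x)) < r" if q: "q \<in> H" for q
            using G[OF q] yx y(2) d(2)[OF q] q by (metis UN_I less_le_trans)
          ultimately show ?thesis using H(4) im y(1) by auto
        qed
        then show "\<exists>G e. finite G \<and> G \<subseteq> seminorms E \<and> 0 < e \<and>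
          (\<forall>y\<in>carrier E. (\<forall>p\<in>G. p (y - x) < e) \<longrightarrow> y \<in> {x \<in> topspace (lc_topology E). u x \<in> V})"
          using H(1) G d(1) by (intro exI[of _ "\<Union>(G ` H)"] exI[of _ d]) auto
      qed auto
    qed
  qed
  then show ?thesis unfolding continuous_linear_def by blast
qed

section \<open>Stability properties of continuous linear maps\<close>

lemma continuous_linear_compose:
  assumes "continuous_linear E F u" "continuous_linear F G v"
  shows "continuous_linear E G (\<lambda>x. v (u x))"
proof -
  have "continuous_map (lc_topology E) (lc_topology G) (v \<circ> u)"
    using assms continuous_map_compose unfolding continuous_linear_def by blast
  then show ?thesis
    using assms unfolding continuous_linear_def clinear_on_def o_def by (auto simp: image_subset_iff)
qed

lemma continuous_linear_cong:
  assumes "continuous_linear E F u" "\<And>x. x \<in> carrier E \<Longrightarrow> u x = v x" "locally_convex E"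
  shows "continuous_linear E F v"
proof -
  have "continuous_map (lc_topology E) (lc_topology F) v"
    by (rule continuous_map_eq[of _ _ u])
      (use assms(1,2) in \<open>simp_all add: continuous_linear_def\<close>)
  moreover have "v ` carrier E \<subseteq> carrier F"
    using assms(1,2) unfolding continuous_linear_def by auto
  moreover have "clinear_on (carrier E) v"
    using assms(1) unfolding continuous_linear_def clinear_on_def
    by (simp add: assms(2)[symmetric] locally_convexD[OF assms(3)])
  ultimately show ?thesis unfolding continuous_linear_def by blast
qed

lemma continuous_linear_add:
  assumes E: "locally_convex E" and F: "locally_convex F"
    and u: "continuous_linear E F u" and v: "continuous_linear E F v"
  shows "continuous_linear E F (\<lambda>x. u x + v x)"
  unfolding continuous_linear_iff[OF E F]
proof (intro conjI ballI allI impI)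
  have im: "u ` carrier E \<subseteq> carrier F" "v ` carrier E \<subseteq> carrier F"
    using u v unfolding continuous_linear_def by auto
  show "(\<lambda>x. u x + v x) ` carrier E \<subseteq> carrier F"
    using im locally_convexD(2)[OF F] by auto
  show "clinear_on (carrier E) (\<lambda>x. u x + v x)"
    using u v unfolding continuous_linear_def clinear_on_def by (auto simp: scaleC_add_right)
  fix q and r :: real assume q: "q \<in> seminorms F" and r: "0 < r"
  then have r2: "0 < r / 2" by simp
  obtain G e where G: "finite G" "G \<subseteq> seminorms E" "0 < e"
    "\<forall>x\<in>carrier E. (\<forall>p\<in>G. p x < e) \<longrightarrow> q (u x) < r / 2"
    using u q r2 unfolding continuous_linear_iff[OF E F] by blast
  obtain H d where H: "finite H" "H \<subseteq> seminorms E" "0 < d"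
    "\<forall>x\<in>carrier E. (\<forall>p\<in>H. p x < d) \<longrightarrow> q (v x) < r / 2"
    using v q r2 unfolding continuous_linear_iff[OF E F] by blast
  have "q (u x + v x) < r" if "x \<in> carrier E" "\<forall>p\<in>G \<union> H. p x < min e d" for x
  proof -
    have "q (u x + v x) \<le> q (u x) + q (v x)"
      using im that(1) by (intro seminormD(2)[OF F q]) auto
    also have "q (u x) < r / 2" using G that by auto
    also have "q (v x) < r / 2" using H that by auto
    finally show ?thesis by simp
  qed
  then show "\<exists>G e. finite G \<and> G \<subseteq> seminorms E \<and> 0 < e \<and>
      (\<forall>x\<in>carrier E. (\<forall>p\<in>G. p x < e) \<longrightarrow> q (u x + v x) < r)"
    using G H by (intro exI[of _ "G \<union> H"] exI[of _ "min e d"]) auto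
qed

text \<open>Supplies the continuity of the summand \<open>T a *\<^sub>C e d\<close> when a
  derivation of the unitization is assembled from a pair.\<close>

lemma continuous_linear_scaleC_vector:
  assumes F: "locally_convex F" and y: "y \<in> carrier F"
  shows "continuous_linear scalars F (\<lambda>c. c *\<^sub>C y)"
  unfolding continuous_linear_iff[OF locally_convex_scalars F]
proof (intro conjI ballI allI impI)
  show "(\<lambda>c. c *\<^sub>C y) ` carrier scalars \<subseteq> carrier F"
    using locally_convexD(4)[OF F y] by auto
  show "clinear_on (carrier scalars) (\<lambda>c. c *\<^sub>C y)"
    unfolding clinear_on_def by (simp add: scaleC_add_left scaleC_scaleC scaleC_complex_def)
  fix q and r :: real assume q: "q \<in> seminorms F" and r: "0 < r"
  have qy: "0 \<le> q y" by (rule seminormD(4)[OF F q y])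
  \<comment> \<open>Adding 1 to the denominator avoids a division by zero when
    \<open>q y = 0\<close>.\<close>
  have "q (c *\<^sub>C y) < r" if "cmod c < r / (q y + 1)" for c
  proof -
    have "q (c *\<^sub>C y) = cmod c * q y" by (rule seminormD(3)[OF F q y])
    also have "\<dots> \<le> cmod c * (q y + 1)" by (intro mult_left_mono) auto
    also have "\<dots> < r" using that qy by (simp add: field_simps)
    finally show ?thesis .
  qed
  then show "\<exists>G e. finite G \<and> G \<subseteq> seminorms scalars \<and> 0 < e \<and>
      (\<forall>x\<in>carrier scalars. (\<forall>p\<in>G. p x < e) \<longrightarrow> q (x *\<^sub>C y) < r)"
    using r qy by (intro exI[of _ "{cmod}"] exI[of _ "r / (q y + 1)"]) (auto simp: seminorm_space_def)
qed

section \<open>Bounded sets, transposes and the strong topology\<close>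

text \<open>A bounded set can be scaled into any neighbourhood of 0, in particular into one that
  \<open>u\<close> maps into the unit ball of \<open>q\<close>; scaling back bounds \<open>q\<close>
  on the image.\<close>

lemma lc_bounded_image:
  assumes E: "locally_convex E" and F: "locally_convex F"
    and u: "continuous_linear E F u" and B: "lc_bounded E B"
  shows "lc_bounded F (u ` B)"
  unfolding lc_bounded_def
proof (intro conjI ballI)
  show "u ` B \<subseteq> carrier F"
    using u B unfolding continuous_linear_def lc_bounded_def by auto
  fix q assume q: "q \<in> seminorms F"
  obtain G e where G: "finite G" "G \<subseteq> seminorms E" "0 < e"
    "\<forall>x\<in>carrier E. (\<forall>p\<in>G. p x < e) \<longrightarrow> q (u x) < 1"
    using u q unfolding continuous_linear_iff[OF E F] by (meson zero_less_one)
  have "\<forall>p\<in>G. \<exists>c. \<forall>x\<in>B. p x \<le> c"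
    using B G(2) unfolding lc_bounded_def bdd_above_def by fastforce
  then obtain c where c: "\<forall>p\<in>G. \<forall>x\<in>B. p x \<le> c p" by metis
  define C where "C = Max (insert 1 (c ` G))"
  have C: "1 \<le> C" "\<And>p. p \<in> G \<Longrightarrow> c p \<le> C" unfolding C_def using G(1) by auto
  have "q (u x) \<le> 2 * C / e" if x: "x \<in> B" for x
  proof -
    have xE: "x \<in> carrier E" using B x unfolding lc_bounded_def by auto
    \<comment> \<open>The factor 2 makes the estimate strict: \<open>p (t *\<^sub>C x)\<close> is at
      most \<open>e / 2\<close> for every \<open>p\<close> in \<open>G\<close>.\<close>
    define t where "t = complex_of_real (e / (2 * C))"
    have t: "cmod t = e / (2 * C)" unfolding t_def using G(3) C(1) by (simp only: norm_of_real) simp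
    have "p (t *\<^sub>C x) < e" if p: "p \<in> G" for p
    proof -
      have "p (t *\<^sub>C x) = e / (2 * C) * p x" using seminormD(3)[OF E subsetD[OF G(2) p] xE] t by simp
      also have "\<dots> \<le> e / (2 * C) * C"
        using c C p x G(3) by (intro mult_left_mono) (auto intro: order_trans)
      also have "\<dots> < e" using C(1) G(3) by simp
      finally show ?thesis .
    qed
    then have "q (u (t *\<^sub>C x)) < 1" using G(4) locally_convexD(4)[OF E xE] by blast
    also have "u (t *\<^sub>C x) = t *\<^sub>C u x" using u xE unfolding continuous_linear_def clinear_on_def by blast
    also have "q (t *\<^sub>C u x) = e / (2 * C) * q (u x)"
      using seminormD(3)[OF F q] u xE t unfolding continuous_linear_def by auto
    finally show ?thesis using G(3) C(1) by (simp add: field_simps)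
  qed
  then show "bdd_above (q ` u ` B)" by (auto simp: bdd_above_def)
qed

text \<open>The normalisation demanded by \<open>strong_dual\<close>; it is also the truncation
  inside \<open>functional\<close>.\<close>

definition restricted :: "'x lcs \<Rightarrow> ('x \<Rightarrow> complex) \<Rightarrow> 'x \<Rightarrow> complex" where
  "restricted E \<phi> = (\<lambda>x. if x \<in> carrier E then \<phi> x else 0)"

lemma restricted_mem_strong_dual:
  assumes "locally_convex E" "continuous_linear E scalars \<phi>"
  shows "restricted E \<phi> \<in> carrier (strong_dual E)"
  unfolding mem_strong_dual_iff
  using continuous_linear_cong[OF assms(2) _ assms(1), of "restricted E \<phi>"]
  by (auto simp: restricted_def)

lemma continuous_linear_transpose:
  assumes E: "locally_convex E" and F: "locally_convex F" and u: "continuous_linear E F u"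
  shows "continuous_linear (strong_dual F) (strong_dual E) (\<lambda>f. restricted E (\<lambda>x. f (u x)))"
  unfolding continuous_linear_iff[OF locally_convex_strong_dual[OF F] locally_convex_strong_dual[OF E]]
proof (intro conjI ballI allI impI)
  show "(\<lambda>f. restricted E (\<lambda>x. f (u x))) ` carrier (strong_dual F) \<subseteq> carrier (strong_dual E)"
    by (auto simp: mem_strong_dual_iff[of _ F]
        intro!: restricted_mem_strong_dual[OF E] continuous_linear_compose[OF u, of scalars])
  show "clinear_on (carrier (strong_dual F)) (\<lambda>f. restricted E (\<lambda>x. f (u x)))"
    unfolding clinear_on_def restricted_def
    by (auto simp: fun_eq_iff plus_fun_def scaleC_fun_def scaleC_complex_def)
  fix q and r :: real assume q: "q \<in> seminorms (strong_dual E)" and r: "0 < r"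
  obtain B where B: "lc_bounded E B" "B \<noteq> {}" "q = (\<lambda>f. SUP x\<in>B. cmod (f x))"
    using q unfolding strong_dual_def by auto
  define q' where "q' = (\<lambda>f. SUP y\<in>u ` B. cmod (f y))"
  have "q' \<in> seminorms (strong_dual F)"
    using lc_bounded_image[OF E F u B(1)] B(2) unfolding q'_def strong_dual_def by auto
  moreover have "q (restricted E (\<lambda>x. f (u x))) = q' f" for f
    unfolding q'_def B(3) image_image restricted_def using B(1)
    by (intro arg_cong[where f = Sup] image_cong) (auto simp: lc_bounded_def)
  ultimately show "\<exists>G e. finite G \<and> G \<subseteq> seminorms (strong_dual F) \<and> 0 < e \<and>
      (\<forall>x\<in>carrier (strong_dual F). (\<forall>p\<in>G. p x < e) \<longrightarrow> q (restricted E (\<lambda>y. x (u y))) < r)"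
    using r by (intro exI[of _ "{q'}"] exI[of _ r]) auto
qed

text \<open>A singleton is bounded, and its strong seminorm is the modulus of the value at that
  point.\<close>

lemma continuous_linear_evaluation:
  assumes E: "locally_convex E" and x: "x \<in> carrier E"
  shows "continuous_linear (strong_dual E) scalars (\<lambda>f. f x)"
  unfolding continuous_linear_iff[OF locally_convex_strong_dual[OF E] locally_convex_scalars]
proof (intro conjI ballI allI impI)
  show "clinear_on (carrier (strong_dual E)) (\<lambda>f. f x)"
    unfolding clinear_on_def by (simp add: plus_fun_def scaleC_fun_def)
  fix q and r :: real assume q: "q \<in> seminorms scalars" and r: "0 < r"
  define q' where "q' = (\<lambda>f. SUP y\<in>{x}. cmod (f y))"
  have "lc_bounded E {x}" using x unfolding lc_bounded_def by simp
  then have "q' \<in> seminorms (strong_dual E)"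
    unfolding q'_def strong_dual_def lcs.simps by blast
  moreover have "q (f x) = q' f" for f
    using q unfolding q'_def seminorm_space_def by simp
  ultimately show "\<exists>G e. finite G \<and> G \<subseteq> seminorms (strong_dual E) \<and> 0 < e \<and>
      (\<forall>f\<in>carrier (strong_dual E). (\<forall>p\<in>G. p f < e) \<longrightarrow> q (f x) < r)"
    using r by (intro exI[of _ "{q'}"] exI[of _ r]) simp
qed simp

text \<open>\<open>pairing\<close> and the actions are written with \<open>inv_into\<close>; on the
  target carrier this agrees with the continuous inverse that the homeomorphism provides.\<close>

lemma lc_iso_continuous_linear:
  assumes h: "lc_iso h E F" and E: "locally_convex E"
  shows "continuous_linear E F h" "continuous_linear F E (inv_into (carrier E) h)"
proof -
  let ?g = "inv_into (carrier E) h"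
  have im: "h ` carrier E = carrier F" and inj: "inj_on h (carrier E)" and
    lin: "clinear_on (carrier E) h" and hom: "homeomorphic_map (lc_topology E) (lc_topology F) h"
    using h unfolding lc_iso_def bij_betw_def by auto
  show "continuous_linear E F h"
    using im lin homeomorphic_imp_continuous_map[OF hom] unfolding continuous_linear_def by auto
  obtain g where g: "homeomorphic_maps (lc_topology E) (lc_topology F) h g"
    using hom homeomorphic_map_maps by blast
  have gh: "?g (h x) = x" if "x \<in> carrier E" for x using that inj by simp
  have eq: "?g y = g y" if y: "y \<in> carrier F" for y
  proof -
    obtain x where x: "x \<in> carrier E" "y = h x" using y im by blast
    have "g (h x) = x" using g x(1) unfolding homeomorphic_maps_def by simp
    then show ?thesis using gh[OF x(1)] x(2) by simp
  qed
  have "continuous_map (lc_topology F) (lc_topology E) ?g"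
  proof (rule continuous_map_eq[of _ _ g])
    show "continuous_map (lc_topology F) (lc_topology E) g"
      using g unfolding homeomorphic_maps_def by blast
  qed (use eq in auto)
  moreover have "clinear_on (carrier F) ?g"
    unfolding clinear_on_def im[symmetric] ball_simps
  proof (intro conjI ballI allI)
    fix x y assume xy: "x \<in> carrier E" "y \<in> carrier E"
    then have "h x + h y = h (x + y)" using lin unfolding clinear_on_def by auto
    then show "?g (h x + h y) = ?g (h x) + ?g (h y)"
      using gh xy locally_convexD(2)[OF E xy] by metis
  next
    fix c x assume x: "x \<in> carrier E"
    then have "c *\<^sub>C h x = h (c *\<^sub>C x)" using lin unfolding clinear_on_def by auto
    then show "?g (c *\<^sub>C h x) = c *\<^sub>C ?g (h x)"
      using gh x locally_convexD(4)[OF E x] by metis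
  qed
  ultimately show "continuous_linear F E ?g"
    unfolding continuous_linear_def im[symmetric] using gh by auto
qed


section \<open>Dual towers\<close>

text \<open>Nothing is known above height \<open>N\<close>. Facts within a level therefore carry a
  bound \<open>k \<le> N\<close>, and facts about a pairing of level \<open>k\<close> with the next
  one carry \<open>k < N\<close>.\<close>

locale algebra_tower =
  fixes p :: "nat \<Rightarrow> 'a::complex_algebra \<Rightarrow> real"
    and N :: nat
    and M :: "('a, 'u::complex_vector) dual_tower"
  assumes frechet: "frechet_algebra p"
    and tower: "is_dual_tower p N M"
begin

abbreviation X :: "nat \<Rightarrow> 'u set" where
  "X k \<equiv> carrier (level M k)"

lemma lc_level: "k \<le> N \<Longrightarrow> locally_convex (level M k)"
  using tower unfolding is_dual_tower_def by blast

lemma lc_algebra: "locally_convex (seminorm_space p)"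
  by (rule locally_convex_seminorm_space[OF frechet_algebra.seminorm[OF frechet]])

lemmas level_0 = locally_convexD(1)[OF lc_level]
lemmas level_add = locally_convexD(2)[OF lc_level]
lemmas level_diff = locally_convexD(3)[OF lc_level]
lemmas level_scale = locally_convexD(4)[OF lc_level]

lemma continuous_linear_step:
  assumes "k < N"
  shows "continuous_linear (strong_dual (level M k)) (level M (Suc k)) (step M k)"
    and "continuous_linear (level M (Suc k)) (strong_dual (level M k))
      (inv_into (carrier (strong_dual (level M k))) (step M k))"
proof -
  have "lc_iso (step M k) (strong_dual (level M k)) (level M (Suc k))"
    using tower assms unfolding is_dual_tower_def by blast
  from lc_iso_continuous_linear[OF this locally_convex_strong_dual[OF lc_level]] assms
  show "continuous_linear (strong_dual (level M k)) (level M (Suc k)) (step M k)"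
    and "continuous_linear (level M (Suc k)) (strong_dual (level M k))
      (inv_into (carrier (strong_dual (level M k))) (step M k))" by simp_all
qed

lemma step_bij: "k < N \<Longrightarrow> bij_betw (step M k) (carrier (strong_dual (level M k))) (X (Suc k))"
  using tower unfolding is_dual_tower_def lc_iso_def by blast

lemma continuous_linear_base:
  "continuous_linear (seminorm_space p) (level M 0) (base M)"
  "continuous_linear (level M 0) (seminorm_space p) (inv (base M))"
proof -
  have "lc_iso (base M) (seminorm_space p) (level M 0)"
    using tower unfolding is_dual_tower_def by blast
  from lc_iso_continuous_linear[OF this lc_algebra]
  show "continuous_linear (seminorm_space p) (level M 0) (base M)"
    "continuous_linear (level M 0) (seminorm_space p) (inv (base M))" by simp_all
qed

lemma base_bij: "bij_betw (base M) UNIV (X 0)"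
  using tower unfolding is_dual_tower_def lc_iso_def by simp

lemma inv_base_base [simp]: "inv (base M) (base M a) = a"
  using base_bij unfolding bij_betw_def by simp

lemma base_inv_base: "x \<in> X 0 \<Longrightarrow> base M (inv (base M) x) = x"
  using base_bij unfolding bij_betw_def by (metis f_inv_into_f)

lemma base_mem [simp]: "base M a \<in> X 0"
  using base_bij unfolding bij_betw_def by blast

section \<open>The pairing of consecutive levels\<close>

lemma functional_mem:
  assumes "k < N" "continuous_linear (level M k) scalars \<phi>"
  shows "functional M k \<phi> \<in> X (Suc k)"
  using continuous_linear_step(1)[OF assms(1)] restricted_mem_strong_dual[OF lc_level assms(2)] assms(1)
  unfolding continuous_linear_def functional_def restricted_def by auto

text \<open>Continuity of \<open>\<phi>\<close> puts its truncation into the strong dual, the set on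
  which \<open>inv_into\<close> undoes \<open>step\<close>. This is why continuity has to be carried
  through every recursive definition below.\<close>

lemma pairing_functional:
  assumes "k < N" "continuous_linear (level M k) scalars \<phi>" "x \<in> X k"
  shows "pairing M k x (functional M k \<phi>) = \<phi> x"
proof -
  have "restricted (level M k) \<phi> \<in> carrier (strong_dual (level M k))"
    using restricted_mem_strong_dual[OF lc_level assms(2)] assms(1) by simp
  then have "inv_into (carrier (strong_dual (level M k))) (step M k)
      (step M k (restricted (level M k) \<phi>)) = restricted (level M k) \<phi>"
    using step_bij[OF assms(1)] unfolding bij_betw_def by simp
  then show ?thesis
    using assms(3) unfolding pairing_def functional_def restricted_def by simp
qed

lemma inv_step_mem:
  assumes "k < N" "f \<in> X (Suc k)"
  shows "inv_into (carrier (strong_dual (level M k))) (step M k) f \<in> carrier (strong_dual (level M k))"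
  using continuous_linear_step(2)[OF assms(1)] assms(2) unfolding continuous_linear_def by blast

lemma pairing_continuous_left:
  assumes "k < N" "f \<in> X (Suc k)"
  shows "continuous_linear (level M k) scalars (\<lambda>x. pairing M k x f)"
  using inv_step_mem[OF assms] unfolding mem_strong_dual_iff pairing_def by blast

lemma pairing_continuous_right:
  assumes "k < N" "x \<in> X k"
  shows "continuous_linear (level M (Suc k)) scalars (pairing M k x)"
proof -
  have "continuous_linear (strong_dual (level M k)) scalars (\<lambda>f. f x)"
    using continuous_linear_evaluation[OF lc_level assms(2)] assms(1) by simp
  from continuous_linear_compose[OF continuous_linear_step(2)[OF assms(1)] this]
  show ?thesis unfolding pairing_def by simp
qed

lemma pairing_linear_left:
  assumes "k < N" "f \<in> X (Suc k)"
  shows "x \<in> X k \<Longrightarrow> y \<in> X k \<Longrightarrow> pairing M k (x + y) f = pairing M k x f + pairing M k y f"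
    and "x \<in> X k \<Longrightarrow> pairing M k (c *\<^sub>C x) f = c * pairing M k x f"
  using pairing_continuous_left[OF assms]
  unfolding continuous_linear_def clinear_on_def scaleC_complex_def by blast+

lemma pairing_linear_right:
  assumes "k < N" "x \<in> X k"
  shows "f \<in> X (Suc k) \<Longrightarrow> g \<in> X (Suc k) \<Longrightarrow>
      pairing M k x (f + g) = pairing M k x f + pairing M k x g"
    and "f \<in> X (Suc k) \<Longrightarrow> pairing M k x (c *\<^sub>C f) = c * pairing M k x f"
  using pairing_continuous_right[OF assms]
  unfolding continuous_linear_def clinear_on_def scaleC_complex_def by blast+

text \<open>Functionals vanish off the carrier, so agreement on the level below determines them.
  This extensionality principle reduces identities at level \<open>k + 1\<close> to identities at
  level \<open>k\<close>.\<close>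

lemma pairing_eqI:
  assumes k: "k < N" and fg: "f \<in> X (Suc k)" "g \<in> X (Suc k)"
    and eq: "\<And>x. x \<in> X k \<Longrightarrow> pairing M k x f = pairing M k x g"
  shows "f = g"
proof -
  let ?g = "inv_into (carrier (strong_dual (level M k))) (step M k)"
  have "?g f x = ?g g x" for x
  proof (cases "x \<in> X k")
    case True
    then show ?thesis using eq unfolding pairing_def by simp
  next
    case False
    then show ?thesis using inv_step_mem[OF k] fg unfolding mem_strong_dual_iff by simp
  qed
  then have "?g f = ?g g" by blast
  then show ?thesis
    using step_bij[OF k] fg unfolding bij_betw_def by (metis inv_into_injective)
qed

end

text \<open>The transpose of \<open>u\<close>, which runs backwards from level \<open>k + 1\<close>
  of \<open>M'\<close> to level \<open>k + 1\<close> of \<open>M\<close>. With both towers equal it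
  also describes the module actions.\<close>

definition dual_map ::
  "('a, 'u::complex_vector) dual_tower \<Rightarrow> ('b, 'v::complex_vector) dual_tower \<Rightarrow> nat \<Rightarrow>
    ('u \<Rightarrow> 'v) \<Rightarrow> 'v \<Rightarrow> 'u" where
  "dual_map M M' k u = (\<lambda>f. functional M k (\<lambda>x. pairing M' k (u x) f))"

lemma
  assumes M: "algebra_tower p N M" and M': "algebra_tower p' N M'" and k: "k < N"
    and u: "continuous_linear (level M k) (level M' k) u"
  shows continuous_linear_dual_map:
      "continuous_linear (level M' (Suc k)) (level M (Suc k)) (dual_map M M' k u)"
    and pairing_dual_map: "x \<in> carrier (level M k) \<Longrightarrow> f \<in> carrier (level M' (Suc k)) \<Longrightarrow>
      pairing M k x (dual_map M M' k u f) = pairing M' k (u x) f"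
proof -
  interpret M: algebra_tower p N M by fact
  interpret M': algebra_tower p' N M' by fact
  have lc: "locally_convex (level M k)" "locally_convex (level M' k)"
    using M.lc_level M'.lc_level k by simp_all
  let ?g = "inv_into (carrier (strong_dual (level M' k))) (step M' k)"
  have "dual_map M M' k u = (\<lambda>f. step M k (restricted (level M k) (\<lambda>x. ?g f (u x))))"
    unfolding dual_map_def functional_def pairing_def restricted_def ..
  with continuous_linear_compose[OF continuous_linear_compose[OF M'.continuous_linear_step(2)[OF k]
        continuous_linear_transpose[OF lc u]] M.continuous_linear_step(1)[OF k]]
  show "continuous_linear (level M' (Suc k)) (level M (Suc k)) (dual_map M M' k u)" by simp
  assume x: "x \<in> carrier (level M k)" and f: "f \<in> carrier (level M' (Suc k))"
  show "pairing M k x (dual_map M M' k u f) = pairing M' k (u x) f"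
    unfolding dual_map_def
    using M.pairing_functional[OF k continuous_linear_compose[OF u M'.pairing_continuous_left[OF k f]] x] .
qed


section \<open>The module structure of the iterated duals\<close>

context algebra_tower
begin

lemma continuous_linear_mult:
  "continuous_linear (seminorm_space p) (seminorm_space p) (\<lambda>a. b * a)"
  "continuous_linear (seminorm_space p) (seminorm_space p) (\<lambda>a. a * b)"
proof -
  have bound: "continuous_linear (seminorm_space p) (seminorm_space p) u"
    if lin: "clinear_on UNIV u" and le: "\<And>l a. p l (u a) \<le> p l b * p l a" for u
    unfolding continuous_linear_iff[OF lc_algebra lc_algebra]
  proof (intro conjI ballI allI impI)
    fix q and r :: real assume q: "q \<in> seminorms (seminorm_space p)" and r: "0 < r"
    obtain l where l: "q = p l" using q unfolding seminorm_space_def by auto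
    have nn: "0 \<le> p l a" for a
      using seminormD(4)[OF lc_algebra, of "p l"] unfolding seminorm_space_def by simp
    have "p l (u a) < r" if a: "p l a < r / (p l b + 1)" for a
    proof -
      have "p l (u a) \<le> (p l b + 1) * p l a" using le[of l a] nn[of a] by (simp add: algebra_simps)
      also have "\<dots> < r" using a nn[of b] by (simp add: field_simps)
      finally show ?thesis .
    qed
    then show "\<exists>G e. finite G \<and> G \<subseteq> seminorms (seminorm_space p) \<and> 0 < e \<and>
        (\<forall>x\<in>carrier (seminorm_space p). (\<forall>p\<in>G. p x < e) \<longrightarrow> q (u x) < r)"
      using r nn[of b] unfolding l
      by (intro exI[of _ "{p l}"] exI[of _ "r / (p l b + 1)"]) (auto simp: seminorm_space_def)
  qed (use lin in auto)
  have sub: "p l (a * c) \<le> p l a * p l c" for l a c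
    using frechet_algebra.submultiplicative[OF frechet] .
  show "continuous_linear (seminorm_space p) (seminorm_space p) (\<lambda>a. b * a)"
    by (rule bound) (simp_all add: clinear_on_def distrib_left mult_scaleC_right sub)
  show "continuous_linear (seminorm_space p) (seminorm_space p) (\<lambda>a. a * b)"
    by (rule bound) (simp_all add: clinear_on_def distrib_right mult_scaleC_left sub mult.commute[of "p _ b"])
qed

text \<open>The left action one level up is the transpose of the right action and vice versa, so
  both statements go through a single induction.\<close>

lemma continuous_linear_act:
  "k \<le> N \<Longrightarrow> continuous_linear (level M k) (level M k) (left_act M k b)"
  "k \<le> N \<Longrightarrow> continuous_linear (level M k) (level M k) (right_act M k b)"
proof (induction k)
  case 0
  have eq: "left_act M 0 b = (\<lambda>x. base M (b * inv (base M) x))"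
    "right_act M 0 b = (\<lambda>x. base M (inv (base M) x * b))" by (auto simp: fun_eq_iff)
  case 1
  show ?case unfolding eq
    by (rule continuous_linear_compose[OF continuous_linear_compose[OF continuous_linear_base(2)
          continuous_linear_mult(1)] continuous_linear_base(1)])
  case 2
  show ?case unfolding eq
    by (rule continuous_linear_compose[OF continuous_linear_compose[OF continuous_linear_base(2)
          continuous_linear_mult(2)] continuous_linear_base(1)])
next
  case (Suc k)
  \<comment> \<open>Passing to the dual interchanges the two sides.\<close>
  have eq: "left_act M (Suc k) b = dual_map M M k (right_act M k b)"
    "right_act M (Suc k) b = dual_map M M k (left_act M k b)"
    unfolding dual_map_def by (auto simp: fun_eq_iff)
  note dual = continuous_linear_dual_map[OF algebra_tower_axioms algebra_tower_axioms]
  case 1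
  then show ?case unfolding eq using dual Suc.IH(2) by simp
  case 2
  then show ?case unfolding eq using dual Suc.IH(1) by simp
qed

lemma act_mem:
  "k \<le> N \<Longrightarrow> x \<in> X k \<Longrightarrow> left_act M k b x \<in> X k"
  "k \<le> N \<Longrightarrow> x \<in> X k \<Longrightarrow> right_act M k b x \<in> X k"
  using continuous_linear_act unfolding continuous_linear_def by blast+

lemma pairing_act:
  assumes "k < N" "x \<in> X k" "f \<in> X (Suc k)"
  shows "pairing M k x (left_act M (Suc k) b f) = pairing M k (right_act M k b x) f"
    and "pairing M k x (right_act M (Suc k) b f) = pairing M k (left_act M k b x) f"
  using pairing_dual_map[OF algebra_tower_axioms algebra_tower_axioms assms(1) _ assms(2,3)]
    continuous_linear_act[of k b] assms(1)
  unfolding dual_map_def by simp_all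

lemma base_linear: "base M (a + b) = base M a + base M b" "base M (c *\<^sub>C a) = c *\<^sub>C base M a"
  using continuous_linear_base(1) unfolding continuous_linear_def clinear_on_def by simp_all

text \<open>Stated for \<open>c *\<^sub>C a + b\<close> so as to apply directly to the splitting of
  an element of the unitization into a multiple of the identity and an element of the
  algebra.\<close>

lemma act_linear_algebra:
  "k \<le> N \<Longrightarrow> x \<in> X k \<Longrightarrow>
    left_act M k (c *\<^sub>C a + b) x = c *\<^sub>C left_act M k a x + left_act M k b x"
  "k \<le> N \<Longrightarrow> x \<in> X k \<Longrightarrow>
    right_act M k (c *\<^sub>C a + b) x = c *\<^sub>C right_act M k a x + right_act M k b x"
proof (induction k arbitrary: x)
  case 0
  {
    case 1
    show ?case by (simp add: base_linear[symmetric] distrib_right mult_scaleC_left)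
  next
    case 2
    show ?case by (simp add: base_linear[symmetric] distrib_left mult_scaleC_right)
  }
next
  case (Suc k)
  {
    case 1
    then show ?case
      by (intro pairing_eqI[of k])
        (simp_all add: act_mem level_add level_scale pairing_linear_right pairing_linear_left
          pairing_act Suc.IH del: left_act.simps right_act.simps)
  next
    case 2
    then show ?case
      by (intro pairing_eqI[of k])
        (simp_all add: act_mem level_add level_scale pairing_linear_right pairing_linear_left
          pairing_act Suc.IH del: left_act.simps right_act.simps)
  }
qed

lemma act_identity:
  assumes u: "\<And>a. u * a = a" "\<And>a. a * u = a"
  shows "k \<le> N \<Longrightarrow> x \<in> X k \<Longrightarrow> left_act M k u x = x \<and> right_act M k u x = x"
proof (induction k arbitrary: x)
  case 0
  then show ?case by (simp add: u base_inv_base)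
next
  case (Suc k)
  then show ?case
    by (auto intro!: pairing_eqI[of k] simp: act_mem pairing_act
        simp del: left_act.simps right_act.simps)
qed

section \<open>The canonical embedding into the even duals\<close>

lemma canonical_mem: "2 * m \<le> N \<Longrightarrow> canonical M m a \<in> X (2 * m)"
proof (induction m)
  case (Suc m)
  then show ?case
    using functional_mem[of "Suc (2 * m)"] pairing_continuous_right[of "2 * m"] by simp
qed simp

lemma pairing_canonical:
  assumes "2 * Suc m \<le> N" "f \<in> X (Suc (2 * m))"
  shows "pairing M (Suc (2 * m)) f (canonical M (Suc m) a) = pairing M (2 * m) (canonical M m a) f"
  using pairing_functional[OF _ pairing_continuous_right[OF _ canonical_mem]] assms by simp

text \<open>The canonical embedding is a bimodule map: a step of the induction climbs two levels,
  and two transpositions bring each action back to its own side.\<close>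

lemma act_canonical:
  "2 * m \<le> N \<Longrightarrow> left_act M (2 * m) b (canonical M m a) = canonical M m (b * a) \<and>
    right_act M (2 * m) b (canonical M m a) = canonical M m (a * b)"
proof (induction m)
  case 0
  then show ?case by simp
next
  case (Suc m)
  have mem: "canonical M (Suc m) c \<in> X (Suc (Suc (2 * m)))" for c
    using canonical_mem[of "Suc m"] Suc.prems by simp
  have "left_act M (Suc (Suc (2 * m))) b (canonical M (Suc m) a) = canonical M (Suc m) (b * a)"
    using Suc mem
    by (intro pairing_eqI[of "Suc (2 * m)"])
      (simp_all add: act_mem pairing_act pairing_canonical canonical_mem
        del: left_act.simps right_act.simps canonical.simps)
  moreover have "right_act M (Suc (Suc (2 * m))) b (canonical M (Suc m) a) = canonical M (Suc m) (a * b)"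
    using Suc mem
    by (intro pairing_eqI[of "Suc (2 * m)"])
      (simp_all add: act_mem pairing_act pairing_canonical canonical_mem
        del: left_act.simps right_act.simps canonical.simps)
  ultimately show ?case by simp
qed

end

section \<open>Duals of the unitization\<close>

abbreviation inclusion :: "'a::zero \<Rightarrow> 'a unitization" where
  "inclusion a \<equiv> Unitization a 0"

text \<open>
  From one level to the next, inclusion and projection are each other's transposes, and so are the
  unit vector and the scalar coordinate; all of them are therefore continuous, without looking at
  the strong topologies again.
\<close>

fun emb :: "('a::complex_algebra, 'u::complex_vector) dual_tower \<Rightarrow>
    ('a unitization, 'v::complex_vector) dual_tower \<Rightarrow> nat \<Rightarrow> 'u \<Rightarrow> 'v"
  and proj :: "('a::complex_algebra, 'u::complex_vector) dual_tower \<Rightarrow>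
    ('a unitization, 'v::complex_vector) dual_tower \<Rightarrow> nat \<Rightarrow> 'v \<Rightarrow> 'u" where
  "emb M M' 0 = (\<lambda>x. base M' (inclusion (inv (base M) x)))"
| "emb M M' (Suc k) = dual_map M' M k (proj M M' k)"
| "proj M M' 0 = (\<lambda>y. base M (alg_part (inv (base M') y)))"
| "proj M M' (Suc k) = dual_map M M' k (emb M M' k)"

fun unit_vector :: "('a::complex_algebra unitization, 'v::complex_vector) dual_tower \<Rightarrow> nat \<Rightarrow> 'v"
  and scalar_coord :: "('a::complex_algebra unitization, 'v::complex_vector) dual_tower \<Rightarrow> nat \<Rightarrow>
    'v \<Rightarrow> complex" where
  "unit_vector M' 0 = base M' (Unitization 0 1)"
| "unit_vector M' (Suc k) = functional M' k (scalar_coord M' k)"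
| "scalar_coord M' 0 = (\<lambda>y. scalar_part (inv (base M') y))"
| "scalar_coord M' (Suc k) = pairing M' k (unit_vector M' k)"

locale unitization_towers =
  M: algebra_tower p N M + M': algebra_tower "unitization_seminorms p" N M'
  for p :: "nat \<Rightarrow> 'a::complex_algebra \<Rightarrow> real" and N :: nat
    and M :: "('a, 'u::complex_vector) dual_tower"
    and M' :: "('a unitization, 'v::complex_vector) dual_tower"
begin

abbreviation J :: "nat \<Rightarrow> 'u \<Rightarrow> 'v" where "J \<equiv> emb M M'"
abbreviation P :: "nat \<Rightarrow> 'v \<Rightarrow> 'u" where "P \<equiv> proj M M'"
abbreviation e :: "nat \<Rightarrow> 'v" where "e \<equiv> unit_vector M'"
abbreviation \<epsilon> :: "nat \<Rightarrow> 'v \<Rightarrow> complex" where "\<epsilon> \<equiv> scalar_coord M'"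

section \<open>Continuity of the coordinates on the duals of the unitization\<close>

lemma continuous_linear_unitization:
  "continuous_linear (seminorm_space p) (seminorm_space (unitization_seminorms p)) inclusion"
  "continuous_linear (seminorm_space (unitization_seminorms p)) (seminorm_space p) alg_part"
  "continuous_linear (seminorm_space (unitization_seminorms p)) scalars scalar_part"
proof -
  have nn: "0 \<le> p l a" for l a
    using seminormD(4)[OF M.lc_algebra, of "p l"] unfolding seminorm_space_def by simp
  note iff = continuous_linear_iff[OF M.lc_algebra M'.lc_algebra]
    continuous_linear_iff[OF M'.lc_algebra M.lc_algebra]
    continuous_linear_iff[OF M'.lc_algebra locally_convex_scalars]
  show "continuous_linear (seminorm_space p) (seminorm_space (unitization_seminorms p)) inclusion"
    unfolding iff
  proof (intro conjI ballI allI impI)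
    fix q and r :: real
    assume "q \<in> seminorms (seminorm_space (unitization_seminorms p))" and r: "0 < r"
    then obtain l where "q = unitization_seminorms p l" unfolding seminorm_space_def by auto
    then show "\<exists>G e. finite G \<and> G \<subseteq> seminorms (seminorm_space p) \<and> 0 < e \<and>
        (\<forall>x\<in>carrier (seminorm_space p). (\<forall>p\<in>G. p x < e) \<longrightarrow> q (inclusion x) < r)"
      using r by (intro exI[of _ "{p l}"] exI[of _ r])
        (auto simp: seminorm_space_def unitization_seminorms_def)
  qed (auto simp: clinear_on_def unitization_defs)
  show "continuous_linear (seminorm_space (unitization_seminorms p)) (seminorm_space p) alg_part"
    unfolding iff
  proof (intro conjI ballI allI impI)
    fix q and r :: real assume "q \<in> seminorms (seminorm_space p)" and r: "0 < r"
    then obtain l where l: "q = p l" unfolding seminorm_space_def by auto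
    have "q (alg_part x) \<le> unitization_seminorms p l x" for x
      unfolding l unitization_seminorms_def by simp
    then have "q (alg_part x) < r" if "unitization_seminorms p l x < r" for x
      using that by (rule le_less_trans)
    then show "\<exists>G e. finite G \<and> G \<subseteq> seminorms (seminorm_space (unitization_seminorms p)) \<and> 0 < e \<and>
        (\<forall>x\<in>carrier (seminorm_space (unitization_seminorms p)). (\<forall>p\<in>G. p x < e) \<longrightarrow>
          q (alg_part x) < r)"
      using r by (intro exI[of _ "{unitization_seminorms p l}"] exI[of _ r])
        (auto simp: seminorm_space_def)
  qed (auto simp: clinear_on_def unitization_defs)
  show "continuous_linear (seminorm_space (unitization_seminorms p)) scalars scalar_part"
    unfolding iff
  proof (intro conjI ballI allI impI)
    fix q and r :: real assume "q \<in> seminorms scalars" and r: "0 < r"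
    then have q: "q = cmod" unfolding seminorm_space_def by auto
    have "q (scalar_part x) \<le> unitization_seminorms p 0 x" for x
      unfolding q unitization_seminorms_def using nn by simp
    then have "q (scalar_part x) < r" if "unitization_seminorms p 0 x < r" for x
      using that by (rule le_less_trans)
    then show "\<exists>G e. finite G \<and> G \<subseteq> seminorms (seminorm_space (unitization_seminorms p)) \<and> 0 < e \<and>
        (\<forall>x\<in>carrier (seminorm_space (unitization_seminorms p)). (\<forall>p\<in>G. p x < e) \<longrightarrow>
          q (scalar_part x) < r)"
      using r by (intro exI[of _ "{unitization_seminorms p 0}"] exI[of _ r])
        (auto simp: seminorm_space_def)
  qed (auto simp: clinear_on_def unitization_defs scaleC_complex_def)
qed

lemma continuous_linear_coords:
  "k \<le> N \<Longrightarrow> continuous_linear (level M k) (level M' k) (J k)"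
  "k \<le> N \<Longrightarrow> continuous_linear (level M' k) (level M k) (P k)"
proof (induction k)
  case 0
  {
    case 1
    show ?case unfolding emb.simps
      by (rule continuous_linear_compose[OF continuous_linear_compose[OF M.continuous_linear_base(2)
            continuous_linear_unitization(1)] M'.continuous_linear_base(1)])
  next
    case 2
    show ?case unfolding proj.simps
      by (rule continuous_linear_compose[OF continuous_linear_compose[OF M'.continuous_linear_base(2)
            continuous_linear_unitization(2)] M.continuous_linear_base(1)])
  }
next
  case (Suc k)
  {
    case 1
    then show ?case unfolding emb.simps
      using continuous_linear_dual_map[OF M'.algebra_tower_axioms M.algebra_tower_axioms] Suc.IH(2)
      by simp
  next
    case 2
    then show ?case unfolding proj.simps
      using continuous_linear_dual_map[OF M.algebra_tower_axioms M'.algebra_tower_axioms] Suc.IH(1)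
      by simp
  }
qed

lemma continuous_linear_scalar_coord:
  "k \<le> N \<Longrightarrow> continuous_linear (level M' k) scalars (\<epsilon> k)"
  "k \<le> N \<Longrightarrow> e k \<in> M'.X k"
proof (induction k)
  case 0
  {
    case 1
    show ?case unfolding scalar_coord.simps
      by (rule continuous_linear_compose[OF M'.continuous_linear_base(2)
            continuous_linear_unitization(3)])
  next
    case 2
    show ?case by simp
  }
next
  case (Suc k)
  {
    case 1
    then show ?case using M'.pairing_continuous_right[of k] Suc.IH(2) by simp
  next
    case 2
    then show ?case using M'.functional_mem[of k] Suc.IH(1) by simp
  }
qed

lemma J_mem: "k \<le> N \<Longrightarrow> x \<in> M.X k \<Longrightarrow> J k x \<in> M'.X k"
  and P_mem: "k \<le> N \<Longrightarrow> y \<in> M'.X k \<Longrightarrow> P k y \<in> M.X k"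
  using continuous_linear_coords unfolding continuous_linear_def by blast+

lemmas e_mem = continuous_linear_scalar_coord(2)

lemma J_linear:
  assumes "k \<le> N" "x \<in> M.X k"
  shows "y \<in> M.X k \<Longrightarrow> J k (x + y) = J k x + J k y" "J k (c *\<^sub>C x) = c *\<^sub>C J k x"
    "y \<in> M.X k \<Longrightarrow> J k (x - y) = J k x - J k y"
proof -
  have J: "clinear_on (M.X k) (J k)"
    using continuous_linear_coords(1)[OF assms(1)] unfolding continuous_linear_def by blast
  then show "y \<in> M.X k \<Longrightarrow> J k (x + y) = J k x + J k y" "J k (c *\<^sub>C x) = c *\<^sub>C J k x"
    using assms(2) unfolding clinear_on_def by blast+
  show "y \<in> M.X k \<Longrightarrow> J k (x - y) = J k x - J k y"
    using clinear_on_diff[OF J] M.lc_level[OF assms(1)] assms(2) unfolding locally_convex_def by blast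
qed

lemma P_linear:
  assumes "k \<le> N" "x \<in> M'.X k"
  shows "y \<in> M'.X k \<Longrightarrow> P k (x + y) = P k x + P k y" "P k (c *\<^sub>C x) = c *\<^sub>C P k x"
  using continuous_linear_coords(2)[OF assms(1)] assms(2)
  unfolding continuous_linear_def clinear_on_def by blast+

lemma \<epsilon>_linear:
  assumes "k \<le> N" "x \<in> M'.X k"
  shows "y \<in> M'.X k \<Longrightarrow> \<epsilon> k (x + y) = \<epsilon> k x + \<epsilon> k y" "\<epsilon> k (c *\<^sub>C x) = c * \<epsilon> k x"
  using continuous_linear_scalar_coord(1)[OF assms(1)] assms(2)
  unfolding continuous_linear_def clinear_on_def scaleC_complex_def by blast+

section \<open>Coordinate identities and the splitting of each level\<close>

text \<open>These are the transposition relations between the coordinates of neighbouring levels;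
  together they say that the pairing of \<open>(x, s)\<close> with \<open>(f, t)\<close> is the
  pairing of \<open>x\<close> with \<open>f\<close> plus \<open>s * t\<close>.\<close>

lemma pairing_coords:
  assumes k: "k < N"
  shows "x \<in> M.X k \<Longrightarrow> g \<in> M'.X (Suc k) \<Longrightarrow> pairing M' k (J k x) g = pairing M k x (P (Suc k) g)"
    and "y \<in> M'.X k \<Longrightarrow> f \<in> M.X (Suc k) \<Longrightarrow> pairing M' k y (J (Suc k) f) = pairing M k (P k y) f"
    and "pairing M' k (e k) g = \<epsilon> (Suc k) g"
    and "y \<in> M'.X k \<Longrightarrow> pairing M' k y (e (Suc k)) = \<epsilon> k y"
  using pairing_dual_map[OF M.algebra_tower_axioms M'.algebra_tower_axioms k, of "J k"]
    pairing_dual_map[OF M'.algebra_tower_axioms M.algebra_tower_axioms k, of "P k"]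
    continuous_linear_coords[of k] k
    M'.pairing_functional[OF k continuous_linear_scalar_coord(1)]
  by simp_all

text \<open>The relations of a direct sum of the level of \<open>A\<close> with the scalars. The
  system is self-dual: transposing the relations at level \<open>k\<close> yields those at level
  \<open>k + 1\<close>, whence the joint induction.\<close>

lemma coords:
  "k \<le> N \<Longrightarrow> P k (e k) = 0 \<and> \<epsilon> k (e k) = 1 \<and> (\<forall>x\<in>M.X k. P k (J k x) = x \<and> \<epsilon> k (J k x) = 0) \<and>
    (\<forall>y\<in>M'.X k. J k (P k y) + \<epsilon> k y *\<^sub>C e k = y)"
proof (induction k)
  case 0
  have "M'.X 0 = base M' ` UNIV" using M'.base_bij unfolding bij_betw_def by simp
  moreover have "base M 0 = 0" using M.base_linear(2)[of 0 0] by simp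
  ultimately show ?case
    by (auto simp: M.base_inv_base M'.base_linear[symmetric] unitization_defs)
next
  case (Suc k)
  then have k: "k < N" "k \<le> N" "Suc k \<le> N"
    and IH: "P k (e k) = 0" "\<epsilon> k (e k) = 1" "\<And>x. x \<in> M.X k \<Longrightarrow> P k (J k x) = x"
      "\<And>x. x \<in> M.X k \<Longrightarrow> \<epsilon> k (J k x) = 0"
      "\<And>y. y \<in> M'.X k \<Longrightarrow> J k (P k y) + \<epsilon> k y *\<^sub>C e k = y"
    by auto
  note mem = J_mem P_mem e_mem[OF k(2)] e_mem[OF k(3)] M.level_0 M'.level_0 M.level_add M'.level_add
    M'.level_scale
  have zero: "pairing M k x 0 = 0" if "x \<in> M.X k" for x
    using M.pairing_linear_right(2)[OF k(1) that M.level_0[OF k(3)], of 0] by simp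
  have zero': "pairing M k 0 f = 0" if "f \<in> M.X (Suc k)" for f
    using M.pairing_linear_left(2)[OF k(1) that M.level_0[OF k(2)], of 0] by simp
  have "P (Suc k) (e (Suc k)) = 0"
    by (rule M.pairing_eqI[OF k(1)])
      (simp_all add: mem k IH zero pairing_coords(1)[symmetric] pairing_coords(4)
        del: emb.simps proj.simps unit_vector.simps scalar_coord.simps)
  moreover have "\<epsilon> (Suc k) (e (Suc k)) = 1"
    by (simp add: mem k IH pairing_coords(3)[symmetric] pairing_coords(4)
        del: emb.simps proj.simps unit_vector.simps scalar_coord.simps)
  moreover have "P (Suc k) (J (Suc k) x) = x" if "x \<in> M.X (Suc k)" for x
    by (rule M.pairing_eqI[OF k(1)])
      (simp_all add: that mem k IH pairing_coords(1)[symmetric] pairing_coords(2)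
        del: emb.simps proj.simps unit_vector.simps scalar_coord.simps)
  moreover have "\<epsilon> (Suc k) (J (Suc k) x) = 0" if "x \<in> M.X (Suc k)" for x
    by (simp add: that mem k IH zero' pairing_coords(3)[symmetric] pairing_coords(2)
        del: emb.simps proj.simps unit_vector.simps scalar_coord.simps)
  moreover have "J (Suc k) (P (Suc k) g) + \<epsilon> (Suc k) g *\<^sub>C e (Suc k) = g" if g: "g \<in> M'.X (Suc k)" for g
  proof (rule M'.pairing_eqI[OF k(1)])
    fix y assume y: "y \<in> M'.X k"
    \<comment> \<open>Both sides are expanded in coordinates, which moves the splitting of
      \<open>g\<close> onto the splitting of \<open>y\<close> already known from the level
      below.\<close>
    have "pairing M' k y (J (Suc k) (P (Suc k) g) + \<epsilon> (Suc k) g *\<^sub>C e (Suc k)) =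
        pairing M k (P k y) (P (Suc k) g) + \<epsilon> (Suc k) g * \<epsilon> k y"
      by (simp add: y g mem k pairing_coords(2,4) M'.pairing_linear_right
          del: emb.simps proj.simps unit_vector.simps scalar_coord.simps)
    also have "\<dots> = pairing M' k (J k (P k y) + \<epsilon> k y *\<^sub>C e k) g"
      by (simp add: y g mem k pairing_coords(1,3) M'.pairing_linear_left
          del: emb.simps proj.simps unit_vector.simps scalar_coord.simps)
    finally show "pairing M' k y (J (Suc k) (P (Suc k) g) + \<epsilon> (Suc k) g *\<^sub>C e (Suc k)) =
        pairing M' k y g"
      using IH(5)[OF y] by simp
  qed (simp_all add: g mem k del: emb.simps proj.simps unit_vector.simps scalar_coord.simps)
  ultimately show ?case by blast
qed

lemmas [simp del] = emb.simps proj.simps unit_vector.simps scalar_coord.simps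

lemma coords_simps:
  assumes "k \<le> N"
  shows "P k (e k) = 0" "\<epsilon> k (e k) = 1"
    "x \<in> M.X k \<Longrightarrow> P k (J k x) = x" "x \<in> M.X k \<Longrightarrow> \<epsilon> k (J k x) = 0"
    "y \<in> M'.X k \<Longrightarrow> J k (P k y) + \<epsilon> k y *\<^sub>C e k = y"
  using coords[OF assms] by blast+

section \<open>The action of the algebra in coordinates\<close>

text \<open>Transposing the even formula: the term that sends the scalar coordinate \<open>s\<close>
  to \<open>s\<close> times \<open>a\<close> becomes the term that sends \<open>f\<close> to its
  pairing with \<open>a\<close>, placed in the scalar coordinate. The step is isolated because it is
  also half of the induction for the even formula.\<close>

lemma act_inclusion_odd_if_even:
  assumes m: "Suc (2 * m) \<le> N" and f: "f \<in> M'.X (Suc (2 * m))"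
    and even: "\<And>x. x \<in> M'.X (2 * m) \<Longrightarrow>
        left_act M' (2 * m) (inclusion a) x =
          J (2 * m) (left_act M (2 * m) a (P (2 * m) x)) + \<epsilon> (2 * m) x *\<^sub>C J (2 * m) (canonical M m a) \<and>
        right_act M' (2 * m) (inclusion a) x =
          J (2 * m) (right_act M (2 * m) a (P (2 * m) x)) + \<epsilon> (2 * m) x *\<^sub>C J (2 * m) (canonical M m a)"
  shows "left_act M' (Suc (2 * m)) (inclusion a) f =
      J (Suc (2 * m)) (left_act M (Suc (2 * m)) a (P (Suc (2 * m)) f)) +
      pairing M (2 * m) (canonical M m a) (P (Suc (2 * m)) f) *\<^sub>C e (Suc (2 * m)) \<and>
    right_act M' (Suc (2 * m)) (inclusion a) f =
      J (Suc (2 * m)) (right_act M (Suc (2 * m)) a (P (Suc (2 * m)) f)) +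
      pairing M (2 * m) (canonical M m a) (P (Suc (2 * m)) f) *\<^sub>C e (Suc (2 * m))"
  using m f
  by (intro conjI M'.pairing_eqI[of "2 * m"])
    (simp_all add: even J_mem P_mem e_mem M.canonical_mem M.act_mem M'.act_mem M'.level_add M'.level_scale
      M'.pairing_act M.pairing_act M'.pairing_linear_left M'.pairing_linear_right pairing_coords
      del: left_act.simps right_act.simps)

text \<open>In even degree \<open>a\<close> acts on \<open>(x, s)\<close> as in the unitization
  itself: \<open>x\<close> is multiplied by \<open>a\<close>, \<open>s\<close> times
  \<open>a\<close> is added, and the scalar coordinate becomes 0. The induction passes through the
  odd level in between.\<close>

lemma act_inclusion_even:
  "2 * m \<le> N \<Longrightarrow> x \<in> M'.X (2 * m) \<Longrightarrow>
      left_act M' (2 * m) (inclusion a) x =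
        J (2 * m) (left_act M (2 * m) a (P (2 * m) x)) + \<epsilon> (2 * m) x *\<^sub>C J (2 * m) (canonical M m a) \<and>
      right_act M' (2 * m) (inclusion a) x =
        J (2 * m) (right_act M (2 * m) a (P (2 * m) x)) + \<epsilon> (2 * m) x *\<^sub>C J (2 * m) (canonical M m a)"
proof (induction m arbitrary: x)
  case 0
  \<comment> \<open>At level 0 the claim is the product formula of the unitization.\<close>
  obtain b s where b: "inv (base M') x = Unitization b s" by (metis unitization.exhaust)
  show ?case
    by (simp add: b M'.base_linear[symmetric] emb.simps proj.simps scalar_coord.simps unitization_defs)
next
  case (Suc m)
  note odd = act_inclusion_odd_if_even[OF _ _ Suc.IH]
  have mem: "canonical M (Suc m) a \<in> M.X (Suc (Suc (2 * m)))"
    using M.canonical_mem[of "Suc m"] Suc.prems by simp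
  show ?case
    using Suc.prems mem
    by (intro conjI M'.pairing_eqI[of "Suc (2 * m)"])
      (simp_all add: odd J_mem P_mem e_mem M.canonical_mem M.act_mem M'.act_mem M'.level_add M'.level_scale
      M'.pairing_act M.pairing_act M'.pairing_linear_left M'.pairing_linear_right pairing_coords
      M.pairing_canonical
      del: left_act.simps right_act.simps canonical.simps)
qed

lemma act_inclusion_odd:
  assumes m: "Suc (2 * m) \<le> N" and f: "f \<in> M'.X (Suc (2 * m))"
  shows "left_act M' (Suc (2 * m)) (inclusion a) f =
      J (Suc (2 * m)) (left_act M (Suc (2 * m)) a (P (Suc (2 * m)) f)) +
      pairing M (2 * m) (canonical M m a) (P (Suc (2 * m)) f) *\<^sub>C e (Suc (2 * m))"
    and "right_act M' (Suc (2 * m)) (inclusion a) f =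
      J (Suc (2 * m)) (right_act M (Suc (2 * m)) a (P (Suc (2 * m)) f)) +
      pairing M (2 * m) (canonical M m a) (P (Suc (2 * m)) f) *\<^sub>C e (Suc (2 * m))"
  using act_inclusion_odd_if_even[OF m f act_inclusion_even[of m _ a]] m by simp_all

text \<open>The identity of the unitization acts trivially on every level, so the scalar part
  contributes a plain multiple of \<open>y\<close> on either side.\<close>

lemma act_unitization:
  assumes "k \<le> N" "y \<in> M'.X k"
  shows "left_act M' k (Unitization a c) y = c *\<^sub>C y + left_act M' k (inclusion a) y"
    and "right_act M' k (Unitization a c) y = c *\<^sub>C y + right_act M' k (inclusion a) y"
proof -
  have eq: "Unitization a c = c *\<^sub>C Unitization 0 1 + inclusion a" by (simp add: unitization_defs)
  have one: "left_act M' k (Unitization 0 1) y = y \<and> right_act M' k (Unitization 0 1) y = y"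
    by (rule M'.act_identity[OF unitization_identity assms])
  show "left_act M' k (Unitization a c) y = c *\<^sub>C y + left_act M' k (inclusion a) y"
    "right_act M' k (Unitization a c) y = c *\<^sub>C y + right_act M' k (inclusion a) y"
    unfolding eq by (simp_all only: M'.act_linear_algebra[OF assms] one)
qed

end

section \<open>Derivations of the unitization\<close>

lemma continuous_derivation_iff:
  "continuous_derivation p M k D \<longleftrightarrow> continuous_linear (seminorm_space p) (level M k) D \<and>
     (\<forall>a b. D (a * b) = left_act M k a (D b) + right_act M k b (D a))"
  unfolding continuous_derivation_def continuous_linear_def by simp

lemma mem_dual_algebra_iff:
  "T \<in> carrier (strong_dual (seminorm_space p)) \<longleftrightarrow> continuous_linear (seminorm_space p) scalars T"
  unfolding mem_strong_dual_iff by simp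

lemma functional_eq_0_if_products_dense:
  assumes dense: "lc_topology (seminorm_space p) closure_of complex_vector.span {a * b | a b. True} = UNIV"
    and T: "T \<in> carrier (strong_dual (seminorm_space p))"
    and zero: "\<And>a b. T (a * b) = 0"
  shows "T = (\<lambda>a. 0)"
proof -
  have lin: "clinear_on UNIV T" and cont: "continuous_map (lc_topology (seminorm_space p)) euclidean T"
    using T unfolding strong_dual_def by auto
  have "T (0 *\<^sub>C 0) = 0 *\<^sub>C T 0" using lin unfolding clinear_on_def by blast
  then have "complex_vector.subspace {a. T a = 0}"
    using lin unfolding complex_vector.subspace_def clinear_on_def by (simp add: scaleC_complex_def)
  then have "complex_vector.span {a * b | a b. True} \<subseteq> {a. T a = 0}"
    using zero by (intro complex_vector.span_minimal) auto
  moreover have "closedin (lc_topology (seminorm_space p)) {a. T a = 0}"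
    using closedin_continuous_map_preimage[OF cont, of "{0}"] by simp
  ultimately have "UNIV \<subseteq> {a. T a = 0}"
    unfolding dense[symmetric] by (rule closure_of_minimal)
  then show ?thesis by auto
qed

context unitization_towers
begin

context
  fixes m
  assumes m: "Suc (2 * m) \<le> N"
begin

private abbreviation "d \<equiv> Suc (2 * m)"
private abbreviation "pair_alg \<equiv> \<lambda>a f. pairing M (2 * m) (canonical M m a) f"

lemma pair_alg_add:
  "f \<in> M.X d \<Longrightarrow> g \<in> M.X d \<Longrightarrow> pair_alg a (f + g) = pair_alg a f + pair_alg a g"
  using M.pairing_linear_right(1)[OF _ M.canonical_mem] m by simp

text \<open>Transposition moves the action onto the canonical image of \<open>a\<close>, where it is
  multiplication in the algebra.\<close>

lemma pair_alg_act:
  assumes "f \<in> M.X d"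
  shows "pair_alg a (left_act M d b f) = pair_alg (a * b) f" "pair_alg a (right_act M d b f) = pair_alg (b * a) f"
  using M.pairing_act[OF _ M.canonical_mem assms] M.act_canonical[of m] m
  by (simp_all del: left_act.simps right_act.simps)

lemma act_unitization_odd:
  assumes "f \<in> M'.X d"
  shows "left_act M' d (Unitization a c) f =
      c *\<^sub>C f + (J d (left_act M d a (P d f)) + pair_alg a (P d f) *\<^sub>C e d)"
    and "right_act M' d (Unitization a c) f =
      c *\<^sub>C f + (J d (right_act M d a (P d f)) + pair_alg a (P d f) *\<^sub>C e d)"
  by (simp_all only: act_unitization[OF m assms, of a c] act_inclusion_odd[OF m assms])

text \<open>Restricting to the algebra and taking coordinates turns a derivation of the unitization
  into the pair of \<open>D\<close> and \<open>T\<close>.\<close>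

lemma derivation_components:
  assumes D: "continuous_derivation (unitization_seminorms p) M' d D"
  shows "continuous_derivation p M d (\<lambda>a. P d (D (inclusion a)))"
    and "(\<lambda>a. \<epsilon> d (D (inclusion a))) \<in> carrier (strong_dual (seminorm_space p))"
    and "\<epsilon> d (D (inclusion (a * b))) = pair_alg a (P d (D (inclusion b))) + pair_alg b (P d (D (inclusion a)))"
proof -
  have cont: "continuous_linear (seminorm_space (unitization_seminorms p)) (level M' d) D"
    and leib: "\<And>x y. D (x * y) = left_act M' d x (D y) + right_act M' d y (D x)"
    using D unfolding continuous_derivation_iff by blast+
  have D_mem: "D x \<in> M'.X d" for x using cont unfolding continuous_linear_def by auto
  note mem = D_mem P_mem[OF m] J_mem[OF m] e_mem[OF m] M.act_mem[OF m]
    M.level_add[OF m] M'.level_add[OF m] M'.level_scale[OF m]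
  have incl: "continuous_linear (seminorm_space p) (level M' d) (\<lambda>a. D (inclusion a))"
    by (rule continuous_linear_compose[OF continuous_linear_unitization(1) cont])
  \<comment> \<open>The Leibniz rule in coordinates: its image under \<open>P d\<close> is the
    Leibniz rule for the first component, its image under \<open>\<epsilon> d\<close> the identity
    for \<open>T\<close>.\<close>
  have prod: "D (inclusion (a * b)) =
      (J d (left_act M d a (P d (D (inclusion b)))) + pair_alg a (P d (D (inclusion b))) *\<^sub>C e d) +
      (J d (right_act M d b (P d (D (inclusion a)))) + pair_alg b (P d (D (inclusion a))) *\<^sub>C e d)" for a b
  proof -
    have "inclusion (a * b) = inclusion a * inclusion b" by (simp add: unitization_defs)
    then show ?thesis by (simp only: leib act_inclusion_odd[OF m D_mem])
  qed
  show "continuous_derivation p M d (\<lambda>a. P d (D (inclusion a)))"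
    unfolding continuous_derivation_iff
  proof (intro conjI allI)
    show "continuous_linear (seminorm_space p) (level M d) (\<lambda>a. P d (D (inclusion a)))"
      by (rule continuous_linear_compose[OF incl continuous_linear_coords(2)[OF m]])
  qed (simp add: prod mem P_linear[OF m] coords_simps[OF m] del: left_act.simps right_act.simps)
  show "(\<lambda>a. \<epsilon> d (D (inclusion a))) \<in> carrier (strong_dual (seminorm_space p))"
    unfolding mem_dual_algebra_iff
    by (rule continuous_linear_compose[OF incl continuous_linear_scalar_coord(1)[OF m]])
  show "\<epsilon> d (D (inclusion (a * b))) = pair_alg a (P d (D (inclusion b))) + pair_alg b (P d (D (inclusion a)))"
    by (simp add: prod mem \<epsilon>_linear[OF m] coords_simps[OF m] del: left_act.simps right_act.simps)
qed

text \<open>Conversely, such a pair defines a derivation that ignores the scalar part of its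
  argument, in accordance with a derivation vanishing at the identity.\<close>

lemma derivation_extension:
  assumes D: "continuous_derivation p M d D"
    and T: "T \<in> carrier (strong_dual (seminorm_space p))"
    and trace_T: "\<And>a b. T (a * b) = pair_alg a (D b) + pair_alg b (D a)"
  shows "continuous_derivation (unitization_seminorms p) M' d
    (\<lambda>x. J d (D (alg_part x)) + T (alg_part x) *\<^sub>C e d)"
  unfolding continuous_derivation_iff
proof (intro conjI allI)
  have cont: "continuous_linear (seminorm_space p) (level M d) D"
    and leib: "\<And>a b. D (a * b) = left_act M d a (D b) + right_act M d b (D a)"
    using D unfolding continuous_derivation_iff by blast+
  have D_mem: "D a \<in> M.X d" for a using cont unfolding continuous_linear_def by auto
  have D_lin: "D (a + b) = D a + D b" "D (c *\<^sub>C a) = c *\<^sub>C D a" for a b c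
    using cont unfolding continuous_linear_def clinear_on_def by simp_all
  have T': "continuous_linear (seminorm_space p) scalars T" using T unfolding mem_dual_algebra_iff .
  then have T_lin: "T (a + b) = T a + T b" "T (c *\<^sub>C a) = c * T a" for a b c
    unfolding continuous_linear_def clinear_on_def by (simp_all add: scaleC_complex_def)
  show "continuous_linear (seminorm_space (unitization_seminorms p)) (level M' d)
      (\<lambda>x. J d (D (alg_part x)) + T (alg_part x) *\<^sub>C e d)"
    by (rule continuous_linear_add[OF M'.lc_algebra M'.lc_level[OF m]
          continuous_linear_compose[OF continuous_linear_compose[OF continuous_linear_unitization(2) cont]
            continuous_linear_coords(1)[OF m]]
          continuous_linear_compose[OF continuous_linear_compose[OF continuous_linear_unitization(2) T']
            continuous_linear_scaleC_vector[OF M'.lc_level[OF m] e_mem[OF m]]]])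
  note mem = D_mem P_mem[OF m] J_mem[OF m] e_mem[OF m] M.act_mem[OF m]
    M.level_add[OF m] M'.level_add[OF m] M'.level_scale[OF m] M.level_scale[OF m]
  fix x y :: "'a unitization"
  obtain a s b t where xy: "x = Unitization a s" "y = Unitization b t"
    by (metis unitization.exhaust)
  let ?D = "\<lambda>a. J d (D a) + T a *\<^sub>C e d"
  have mem_D: "?D a \<in> M'.X d" for a by (simp add: mem)
  have PD: "P d (?D a) = D a" for a by (simp add: mem P_linear[OF m] coords_simps[OF m])
  show "J d (D (alg_part (x * y))) + T (alg_part (x * y)) *\<^sub>C e d =
      left_act M' d x (J d (D (alg_part y)) + T (alg_part y) *\<^sub>C e d) +
      right_act M' d y (J d (D (alg_part x)) + T (alg_part x) *\<^sub>C e d)"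
    \<comment> \<open>The mixed terms \<open>t *\<^sub>C a\<close> and \<open>s *\<^sub>C b\<close>
      of the product are matched by the multiples through which the scalar parts \<open>s\<close>
      and \<open>t\<close> act.\<close>
    unfolding xy unitization.sel act_unitization_odd[OF mem_D] PD
    by (simp add: times_unitization_def D_lin T_lin leib trace_T mem J_linear[OF m]
        scaleC_add_left scaleC_add_right scaleC_scaleC add_ac del: left_act.simps right_act.simps)
qed

text \<open>The scalar part of \<open>x\<close> and the coefficient of \<open>e d\<close> enter the
  left and the right action equally, so they cancel; a commutator has scalar coordinate 0.\<close>

lemma commutator_unitization:
  assumes y: "y \<in> M'.X d"
  shows "left_act M' d x y - right_act M' d x y =
    J d (left_act M d (alg_part x) (P d y) - right_act M d (alg_part x) (P d y))"
proof -
  obtain a s where x: "x = Unitization a s" by (metis unitization.exhaust)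
  show ?thesis
    unfolding x act_unitization_odd[OF y]
    by (simp add: y J_linear[OF m] M.act_mem[OF m] P_mem[OF m]
        del: left_act.simps right_act.simps)
qed

section \<open>The two implications\<close>

text \<open>The derivation built from \<open>D\<close> and \<open>T\<close> is a commutator; its
  first coordinate shows that \<open>D\<close> is inner, its scalar coordinate that \<open>T\<close>
  is zero.\<close>

lemma weakly_amenable_unitizationD:
  assumes wa: "weakly_amenable (unitization_seminorms p) M' d"
    and D: "continuous_derivation p M d D"
    and T: "T \<in> carrier (strong_dual (seminorm_space p))"
    and trace_T: "\<And>a b. T (a * b) = pair_alg a (D b) + pair_alg b (D a)"
  shows "inner_derivation M d D \<and> T = (\<lambda>a. 0)"
proof -
  obtain y where y: "y \<in> M'.X d"
    "\<And>x. J d (D (alg_part x)) + T (alg_part x) *\<^sub>C e d = left_act M' d x y - right_act M' d x y"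
    using wa[unfolded weakly_amenable_def inner_derivation_def, rule_format,
        OF derivation_extension[OF D T trace_T]] by (elim bexE) simp
  \<comment> \<open>Only the first coordinate of \<open>y\<close> affects the commutator.\<close>
  define f where "f = P d y"
  have f: "f \<in> M.X d" unfolding f_def by (rule P_mem[OF m y(1)])
  have D_mem: "D a \<in> M.X d" for a
    using D unfolding continuous_derivation_def by blast
  have diff_mem: "left_act M d a f - right_act M d a f \<in> M.X d" for a
    by (intro M.level_diff M.act_mem m f)
  have eq: "J d (D a) + T a *\<^sub>C e d = J d (left_act M d a f - right_act M d a f)" for a
    using y(2)[of "inclusion a"] unfolding commutator_unitization[OF y(1)] f_def by simp
  note mem = D_mem J_mem[OF m] e_mem[OF m] M'.level_scale[OF m] diff_mem
  have "D a = left_act M d a f - right_act M d a f" for a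
    using arg_cong[OF eq[of a], of "P d"]
    by (simp add: mem P_linear[OF m] coords_simps[OF m] del: left_act.simps right_act.simps)
  then have "inner_derivation M d D" unfolding inner_derivation_def using f by (intro bexI allI)
  moreover have "T a = 0" for a
    using arg_cong[OF eq[of a], of "\<epsilon> d"]
    by (simp add: mem \<epsilon>_linear[OF m] coords_simps[OF m] del: left_act.simps right_act.simps)
  ultimately show ?thesis by (simp add: fun_eq_iff)
qed

text \<open>The first component of \<open>D\<close> is inner by assumption, which forces the scalar
  component to vanish on products and then, by density, everywhere.\<close>

lemma weakly_amenable_unitizationI:
  assumes dense: "lc_topology (seminorm_space p) closure_of complex_vector.span {a * b | a b. True} = UNIV"
    and inner: "\<And>D T. continuous_derivation p M d D \<Longrightarrow>
      T \<in> carrier (strong_dual (seminorm_space p)) \<Longrightarrow>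
      (\<And>a b. T (a * b) = pair_alg a (D b) + pair_alg b (D a)) \<Longrightarrow> inner_derivation M d D"
  shows "weakly_amenable (unitization_seminorms p) M' d"
  unfolding weakly_amenable_def
proof (intro allI impI)
  fix D assume D: "continuous_derivation (unitization_seminorms p) M' d D"
  have lin: "D (x + y) = D x + D y" "D (c *\<^sub>C x) = c *\<^sub>C D x" "D x \<in> M'.X d"
    and leib: "D (x * y) = left_act M' d x (D y) + right_act M' d y (D x)" for x y c
    using D unfolding continuous_derivation_def clinear_on_def by blast+
  note comp = derivation_components[OF D]
  obtain f where f: "f \<in> M.X d"
    "\<And>a. P d (D (inclusion a)) = left_act M d a f - right_act M d a f"
    using inner[OF comp] unfolding inner_derivation_def by blast
  \<comment> \<open>With this formula the sum of the pairings of \<open>a\<close> with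
    \<open>[b, f]\<close> and of \<open>b\<close> with \<open>[a, f]\<close> cancels, where
    \<open>[b, f]\<close> is the commutator of \<open>b\<close> with \<open>f\<close>.\<close>
  have pair_alg_diff: "pair_alg a (left_act M d b f - right_act M d b f) = pair_alg (a * b) f - pair_alg (b * a) f"
    for a b
  proof -
    have "pair_alg a (left_act M d b f - right_act M d b f + right_act M d b f) =
        pair_alg a (left_act M d b f - right_act M d b f) + pair_alg a (right_act M d b f)"
      by (intro pair_alg_add M.level_diff M.act_mem m f)
    then show ?thesis by (simp add: pair_alg_act[OF f(1)] del: left_act.simps right_act.simps)
  qed
  have "(\<lambda>a. \<epsilon> d (D (inclusion a))) = (\<lambda>a. 0)"
    by (rule functional_eq_0_if_products_dense[OF dense comp(2)])
      (simp add: comp(3) f(2) pair_alg_diff del: left_act.simps right_act.simps)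
  then have "\<epsilon> d (D (inclusion a)) = 0" for a by (rule fun_cong)
  then have D_incl: "D (inclusion a) = J d (left_act M d a f - right_act M d a f)" for a
    using coords_simps(5)[OF m lin(3), of "inclusion a"] f(2) by simp
  \<comment> \<open>The Leibniz rule at the identity times itself reads
    \<open>D 1 = D 1 + D 1\<close>.\<close>
  have "D (Unitization 0 1) = 0"
    using leib[of "Unitization 0 1" "Unitization 0 1"]
      M'.act_identity[OF unitization_identity m lin(3), of "Unitization 0 1"]
    by (simp add: unitization_identity del: left_act.simps right_act.simps)
  moreover have "x = scalar_part x *\<^sub>C Unitization 0 1 + inclusion (alg_part x)" for x :: "'a unitization"
    by (simp add: unitization_defs)
  ultimately have "D x = D (inclusion (alg_part x))" for x
    using lin(1,2) by (metis add_0 complex_vector.scale_zero_right)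
  \<comment> \<open>The lift \<open>J d f\<close> with scalar coordinate 0 implements
    \<open>D\<close>, since its commutator depends on the algebra part of \<open>x\<close> alone, as
    does \<open>D\<close>.\<close>
  then have "D x = left_act M' d x (J d f) - right_act M' d x (J d f)" for x
    unfolding commutator_unitization[OF J_mem[OF m f(1)]] coords_simps(3)[OF m f(1)] by (simp add: D_incl)
  then show "inner_derivation M' d D"
    unfolding inner_derivation_def using J_mem[OF m f(1)] by blast
qed

end

end

theorem proposition3p14:
  fixes p :: "nat \<Rightarrow> 'a::complex_algebra \<Rightarrow> real"
    and n :: nat
    and M :: "('a, 'u::complex_vector) dual_tower"
    and M' :: "('a unitization, 'v::complex_vector) dual_tower"
  assumes "frechet_algebra p"
    and "\<not> unital TYPE('a)"
    and "self_induced p"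
    and "n \<ge> 1"
    and "is_dual_tower p (2 * n + 1) M"
    and "is_dual_tower (unitization_seminorms p) (2 * n + 1) M'"
  shows "(weakly_amenable (unitization_seminorms p) M' (2 * n + 1) \<longleftrightarrow>
           (\<forall>D. continuous_derivation p M (2 * n + 1) D \<and>
                (\<exists>T\<in>carrier (strong_dual (seminorm_space p)). \<forall>a b.
                   T (a * b) = pairing M (2 * n) (canonical M n a) (D b)
                             + pairing M (2 * n) (canonical M n b) (D a)) \<longrightarrow>
                inner_derivation M (2 * n + 1) D)) \<and>
         (weakly_amenable (unitization_seminorms p) M' (2 * n + 1) \<longrightarrow>
           (\<forall>D. \<forall>T\<in>carrier (strong_dual (seminorm_space p)).
                continuous_derivation p M (2 * n + 1) D \<and>
                (\<forall>a b. T (a * b) = pairing M (2 * n) (canonical M n a) (D b)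
                                 + pairing M (2 * n) (canonical M n b) (D a)) \<longrightarrow>
                T = (\<lambda>a. 0)))"
proof -
  interpret unitization_towers p "2 * n + 1" M M'
    using assms by (intro unitization_towers.intro algebra_tower.intro frechet_algebra_unitization)
  have m: "Suc (2 * n) \<le> 2 * n + 1" by simp
  have dense: "lc_topology (seminorm_space p) closure_of complex_vector.span {a * b | a b. True} = UNIV"
    using \<open>self_induced p\<close> unfolding self_induced_def Let_def by blast
  have eq: "2 * n + 1 = Suc (2 * n)" by simp
  show ?thesis
    unfolding eq
    using weakly_amenable_unitizationD[OF m] weakly_amenable_unitizationI[OF m dense] by blast
qed

end
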